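(* Let $I,J\subset\mathbb{R}$ be open intervals, let $f:I\to\mathbb{R}$ and $h:J\to\mathbb{R}$ be smooth functions, and let $M^2$ be the translation surface parametrized by $\phi:I\times J\to\mathbb{R}^3$, $\phi(u,v)=(u,v,f(u)+h(v))$, with the Riemannian metric induced from $\mathbb{R}^3$, $$g=(1+f'^2)\,du^2+2f'h'\,du\,dv+(1+h'^2)\,dv^2 .$$ Then the coordinate vector fields $\frac{\partial}{\partial u}$ and $\frac{\partial}{\partial v}$ are both harmonic sections on $(M^2,g)$ if and only if the following four equations hold for all $(u,v)\in I\times J$ (where $f',f'',f'''$ are evaluated at $u$ and $h',h'',h'''$ at $v$): $$f''^2(1+h'^2)(1+h'^2-f'^2)+f'f'''(1+h'^2)(1+h'^2+f'^2)-f'^2f''h''(1+f'^2-h'^2)=0,$$ $$h'\left[f'''(1+h'^2)(1+f'^2+h'^2)-2f'f''\left(h''(1+f'^2)+f''(1+h'^2)\right)\right]=0,$$ $$f'\left[h'''(1+f'^2)(1+f'^2+h'^2)-2h'h''\left(f''(1+h'^2)+h''(1+f'^2)\right)\right]=0,$$ $$h''^2(1+f'^2)(1+f'^2-h'^2)+h'h'''(1+f'^2)(1+f'^2+h'^2)-h'^2h''f''(1+h'^2-f'^2)=0.$$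
   Context: A smooth vector field $X$ on a Riemannian manifold $(M,g)$ with Levi-Civita connection $\nabla$ is called a harmonic section if its rough Laplacian vanishes: $\Delta X=\operatorname{Tr}_g\nabla^2X=\sum_i\left(\nabla_{e_i}\nabla_{e_i}X-\nabla_{\nabla_{e_i}e_i}X\right)=0$, where $\{e_i\}$ is any local orthonormal frame. (This is the Euler–Lagrange equation of the vertical energy $\frac12\int_D|\nabla X|^2v^g$.) The fields $\frac{\partial}{\partial u},\frac{\partial}{\partial v}$ are the coordinate vector fields of the parametrization $\phi$, identified with $\phi_u=(1,0,f')$ and $\phi_v=(0,1,h')$; equivalently one may work on $I\times J$ with the metric $g$. *)

theory Defs
  imports "HOL-Analysis.Analysis"
begin

section \<open>Smooth maps on open sets\<close>

primrec Ck_on :: "nat \<Rightarrow> 'a::euclidean_space set \<Rightarrow> ('a \<Rightarrow> 'b::euclidean_space) \<Rightarrow> bool" where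
  "Ck_on 0 S F \<longleftrightarrow> continuous_on S F"
| "Ck_on (Suc k) S F \<longleftrightarrow>
     (\<forall>x\<in>S. F differentiable (at x)) \<and> (\<forall>v. Ck_on k S (\<lambda>x. frechet_derivative F (at x) v))"

text \<open>The predicate is meant for open \<open>S\<close>: derivatives are taken at full neighbourhoods.\<close>

definition smooth_on :: "'a::euclidean_space set \<Rightarrow> ('a \<Rightarrow> 'b::euclidean_space) \<Rightarrow> bool" where
  "smooth_on S F \<longleftrightarrow> (\<forall>k. Ck_on k S F)"

lemma Ck_on_cong:
  assumes "open S" "Ck_on k S F" "\<And>x. x \<in> S \<Longrightarrow> F x = G x"
  shows "Ck_on k S G"
  using assms(2,3)
proof (induction k arbitrary: F G)
  case 0
  then show ?case by (auto cong: continuous_on_cong)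
next
  case (Suc k)
  have d: "(G has_derivative frechet_derivative F (at x)) (at x)" if "x \<in> S" for x
    using Suc.prems that frechet_derivative_works[of F "at x"]
    by (auto intro: has_derivative_transform_within_open[OF _ assms(1) that])
  have eq: "frechet_derivative F (at x) v = frechet_derivative G (at x) v" if "x \<in> S" for x v
    using frechet_derivative_at[OF d[OF that]] by simp
  have "Ck_on k S (\<lambda>x. frechet_derivative G (at x) v)" for v
    by (rule Suc.IH[where F = "\<lambda>x. frechet_derivative F (at x) v"]) (use Suc.prems eq in auto)
  then show ?case using d by (auto simp: differentiable_def)
qed

lemma Ck_on_Suc_imp: "Ck_on (Suc k) S F \<Longrightarrow> Ck_on k S F"
proof (induction k arbitrary: F)
  case 0
  then show ?case
    by (auto intro!: continuous_at_imp_continuous_on differentiable_imp_continuous_within)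
qed auto

lemma Ck_on_add:
  assumes "open S" "Ck_on k S F" "Ck_on k S G"
  shows "Ck_on k S (\<lambda>x. F x + G x)"
  using assms(2,3)
proof (induction k arbitrary: F G)
  case 0
  then show ?case by (auto intro: continuous_intros)
next
  case (Suc k)
  have d: "((\<lambda>x. F x + G x) has_derivative
      (\<lambda>v. frechet_derivative F (at x) v + frechet_derivative G (at x) v)) (at x)" if "x \<in> S" for x
    using Suc.prems that by (auto intro!: has_derivative_add simp: frechet_derivative_works)
  have "Ck_on k S (\<lambda>x. frechet_derivative (\<lambda>x. F x + G x) (at x) v)" for v
    by (rule Ck_on_cong[OF assms(1) Suc.IH[of "\<lambda>x. frechet_derivative F (at x) v"
            "\<lambda>x. frechet_derivative G (at x) v"]])
      (use Suc.prems frechet_derivative_at[OF d, symmetric] in auto)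
  then show ?case using d by (auto simp: differentiable_def)
qed

lemma Ck_on_mult:
  fixes F G :: "'a::euclidean_space \<Rightarrow> real"
  assumes "open S" "Ck_on k S F" "Ck_on k S G"
  shows "Ck_on k S (\<lambda>x. F x * G x)"
  using assms(2,3)
proof (induction k arbitrary: F G)
  case 0
  then show ?case by (auto intro: continuous_intros)
next
  case (Suc k)
  have d: "((\<lambda>x. F x * G x) has_derivative
      (\<lambda>v. F x * frechet_derivative G (at x) v + frechet_derivative F (at x) v * G x)) (at x)"
    if "x \<in> S" for x
    using Suc.prems that by (auto intro!: has_derivative_mult simp: frechet_derivative_works)
  have "Ck_on k S F" "Ck_on k S G" using Suc.prems Ck_on_Suc_imp by blast+
  then have "Ck_on k S (\<lambda>x. F x * frechet_derivative G (at x) v + frechet_derivative F (at x) v * G x)" for v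
    using Suc.prems by (intro Ck_on_add assms(1) Suc.IH) auto
  then have "Ck_on k S (\<lambda>x. frechet_derivative (\<lambda>x. F x * G x) (at x) v)" for v
    by (rule Ck_on_cong[OF assms(1)]) (use frechet_derivative_at[OF d, symmetric] in auto)
  then show ?case using d by (auto simp: differentiable_def)
qed

lemma Ck_on_const: "Ck_on k S (\<lambda>x. c)"
proof (induction k arbitrary: c)
  case 0
  show ?case by simp
next
  case (Suc k)
  show ?case using Suc.IH[of 0] by (simp add: frechet_derivative_const)
qed

lemma Ck_on_nth:
  fixes F :: "real \<Rightarrow> real" and i :: "'n::finite"
  assumes "open S" "Ck_on k I F" "\<And>p. p \<in> S \<Longrightarrow> p $ i \<in> I"
  shows "Ck_on k S (\<lambda>p :: real ^ 'n. F (p $ i))"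
  using assms(2)
proof (induction k arbitrary: F)
  case 0
  then show ?case
    using assms(3) by (auto intro!: continuous_on_compose2[of I F S "\<lambda>p. p $ i"] continuous_intros)
next
  case (Suc k)
  have d: "((\<lambda>p. F (p $ i)) has_derivative (\<lambda>v. frechet_derivative F (at (p $ i)) (v $ i))) (at p)"
    if "p \<in> S" for p
  proof -
    have "((\<lambda>p. p $ i) has_derivative (\<lambda>v. v $ i)) (at p)"
      by (rule bounded_linear.has_derivative[OF bounded_linear_vec_nth has_derivative_ident])
    moreover have "(F has_derivative frechet_derivative F (at (p $ i))) (at (p $ i))"
      using Suc.prems assms(3)[OF that] by (simp add: frechet_derivative_works)
    ultimately show ?thesis by (rule has_derivative_compose)
  qed
  have "Ck_on k S (\<lambda>p. frechet_derivative F (at (p $ i)) (v $ i))" for v :: "real ^ 'n"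
    by (rule Suc.IH) (use Suc.prems in auto)
  then have "Ck_on k S (\<lambda>p. frechet_derivative (\<lambda>p. F (p $ i)) (at p) v)" for v
    by (rule Ck_on_cong[OF assms(1)]) (use frechet_derivative_at[OF d, symmetric] in auto)
  then show ?case using d by (auto simp: differentiable_def)
qed

lemma smooth_on_deriv:
  fixes F :: "real \<Rightarrow> real"
  assumes "open S" "smooth_on S F"
  shows "smooth_on S (deriv F)"
  unfolding smooth_on_def
proof
  fix k
  have F: "Ck_on (Suc k) S F" using assms(2) unfolding smooth_on_def by blast
  have "frechet_derivative F (at x) 1 = deriv F x" if "x \<in> S" for x
    using F that frechet_derivative_at[of F "\<lambda>t. deriv F x * t" x]
    by (metis Ck_on.simps(2) DERIV_deriv_iff_real_differentiable has_field_derivative_def mult.right_neutral)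
  then show "Ck_on k S (deriv F)"
    by (rule Ck_on_cong[OF assms(1), of k "\<lambda>x. frechet_derivative F (at x) 1", rotated]) (use F in auto)
qed

section \<open>Riemannian metrics and the Levi-Civita connection on open subsets of \<open>\<real>\<^sup>n\<close>\<close>

text \<open>
  On an open set \<open>U\<close> every tangent space is \<open>real ^ 'n\<close>, so vector fields are maps
  \<open>real ^ 'n \<Rightarrow> real ^ 'n\<close>, of which only the values on \<open>U\<close> matter, and a metric \<open>g\<close> sends a
  point \<open>p\<close> to a bilinear form \<open>g p\<close>.
\<close>

type_synonym 'n vfield = "real ^ 'n \<Rightarrow> real ^ 'n"
type_synonym 'n metric = "real ^ 'n \<Rightarrow> real ^ 'n \<Rightarrow> real ^ 'n \<Rightarrow> real"

definition coord_field :: "'n \<Rightarrow> ('n::finite) vfield" where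
  "coord_field i = (\<lambda>p. axis i 1)"

definition metric_matrix :: "('n::finite) metric \<Rightarrow> real ^ 'n \<Rightarrow> real ^ 'n ^ 'n" where
  "metric_matrix g p = (\<chi> i j. g p (coord_field i p) (coord_field j p))"

definition riemannian_metric_on :: "(real ^ 'n) set \<Rightarrow> ('n::finite) metric \<Rightarrow> bool" where
  "riemannian_metric_on U g \<longleftrightarrow>
     (\<forall>p\<in>U. bilinear (g p)) \<and>
     (\<forall>p\<in>U. \<forall>x y. g p x y = g p y x) \<and>
     (\<forall>p\<in>U. \<forall>x. x \<noteq> 0 \<longrightarrow> g p x x > 0) \<and>
     (\<forall>i j. smooth_on U (\<lambda>p. metric_matrix g p $ i $ j))"

definition pderiv_at :: "'n \<Rightarrow> (real ^ 'n \<Rightarrow> real) \<Rightarrow> real ^ ('n::finite) \<Rightarrow> real" where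
  "pderiv_at i F p = frechet_derivative F (at p) (axis i 1)"

text \<open>The Christoffel symbol \<open>\<Gamma>\<^sup>k\<^sub>i\<^sub>j\<close> at \<open>p\<close> is \<open>christoffel g p k i j\<close>.\<close>

definition christoffel :: "('n::finite) metric \<Rightarrow> real ^ 'n \<Rightarrow> 'n \<Rightarrow> 'n \<Rightarrow> 'n \<Rightarrow> real" where
  "christoffel g p k i j =
     (\<Sum>l\<in>UNIV. matrix_inv (metric_matrix g p) $ k $ l *
        (pderiv_at i (\<lambda>q. metric_matrix g q $ j $ l) p
         + pderiv_at j (\<lambda>q. metric_matrix g q $ i $ l) p
         - pderiv_at l (\<lambda>q. metric_matrix g q $ i $ j) p)) / 2"

text \<open>
  \<open>cov_deriv g X Y\<close> is \<open>\<nabla>\<^sub>X Y\<close>. The lemmas \<open>cov_deriv_torsion_free\<close> and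
  \<open>cov_deriv_metric_compatible\<close> below confirm that this is the Levi-Civita connection.
\<close>

definition cov_deriv :: "('n::finite) metric \<Rightarrow> 'n vfield \<Rightarrow> 'n vfield \<Rightarrow> 'n vfield" where
  "cov_deriv g X Y p =
     frechet_derivative Y (at p) (X p)
     + (\<chi> k. \<Sum>i\<in>UNIV. \<Sum>j\<in>UNIV. christoffel g p k i j * X p $ i * Y p $ j)"

lemma matrix_inv_metric:
  assumes g: "riemannian_metric_on U g" and p: "p \<in> U"
  shows "metric_matrix g p ** matrix_inv (metric_matrix g p) = mat 1"
proof -
  have bl: "bilinear (g p)" and pd: "\<And>x. x \<noteq> 0 \<Longrightarrow> g p x x > 0"
    using g p unfolding riemannian_metric_on_def by auto
  have lin: "linear (\<lambda>x. g p x y)" "linear (g p x)" for x y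
    using bl unfolding bilinear_def by auto
  have ker: "x = 0" if "metric_matrix g p *v x = 0" for x
  proof (rule ccontr)
    assume "x \<noteq> 0"
    have ex: "y = (\<Sum>i\<in>UNIV. y $ i *\<^sub>R axis i 1)" for y :: "real ^ 'a"
      by (simp add: basis_expansion flip: scalar_mult_eq_scaleR)
    have "g p x x = (\<Sum>i\<in>UNIV. x $ i * g p (axis i 1) x)"
      by (subst (1) ex[of x]) (simp add: linear_sum[OF lin(1)] linear_cmul[OF lin(1)])
    also have "\<dots> = (\<Sum>i\<in>UNIV. x $ i * (\<Sum>j\<in>UNIV. x $ j * g p (axis i 1) (axis j 1)))"
    proof (intro sum.cong refl)
      fix i
      have "g p (axis i 1) x = (\<Sum>j\<in>UNIV. x $ j * g p (axis i 1) (axis j 1))"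
        by (subst (1) ex[of x]) (simp add: linear_sum[OF lin(2)] linear_cmul[OF lin(2)])
      then show "x $ i * g p (axis i 1) x = x $ i * (\<Sum>j\<in>UNIV. x $ j * g p (axis i 1) (axis j 1))"
        by simp
    qed
    also have "\<dots> = (\<Sum>i\<in>UNIV. x $ i * (metric_matrix g p *v x) $ i)"
      by (simp add: matrix_vector_mult_def metric_matrix_def coord_field_def mult.commute)
    also have "\<dots> = 0" using that by simp
    finally show False using pd[OF \<open>x \<noteq> 0\<close>] by simp
  qed
  then have "invertible (metric_matrix g p)"
    using invertible_left_inverse matrix_left_invertible_ker by blast
  then show ?thesis
    unfolding invertible_def matrix_inv_def by (rule someI2_ex) simp
qed

lemma metric_matrix_sym:
  assumes "riemannian_metric_on U g" "p \<in> U"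
  shows "metric_matrix g p $ i $ j = metric_matrix g p $ j $ i"
  using assms unfolding riemannian_metric_on_def metric_matrix_def by auto

lemma metric_matrix_differentiable:
  assumes "riemannian_metric_on U g" "p \<in> U"
  shows "(\<lambda>q. metric_matrix g q $ i $ j) differentiable (at p)"
proof -
  have "Ck_on (Suc 0) U (\<lambda>q. metric_matrix g q $ i $ j)"
    using assms unfolding riemannian_metric_on_def smooth_on_def by blast
  then show ?thesis using assms(2) by simp
qed

lemma pderiv_metric_sym:
  assumes g: "riemannian_metric_on U g" and U: "open U" and p: "p \<in> U"
  shows "pderiv_at l (\<lambda>q. metric_matrix g q $ i $ j) p = pderiv_at l (\<lambda>q. metric_matrix g q $ j $ i) p"
  unfolding pderiv_at_def
  by (subst frechet_derivative_transform_within_open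
        [OF metric_matrix_differentiable[OF g p] U p metric_matrix_sym[OF g]]) auto

lemma cov_deriv_torsion_free:
  assumes g: "riemannian_metric_on U g" and U: "open U" and p: "p \<in> U"
  shows "cov_deriv g X Y p - cov_deriv g Y X p =
         frechet_derivative Y (at p) (X p) - frechet_derivative X (at p) (Y p)"
proof -
  have sym: "christoffel g p k i j = christoffel g p k j i" for k i j
    unfolding christoffel_def using pderiv_metric_sym[OF g U p, of _ i j]
    by (auto simp: algebra_simps)
  have "(\<Sum>i\<in>UNIV. \<Sum>j\<in>UNIV. christoffel g p k i j * X p $ i * Y p $ j) =
        (\<Sum>i\<in>UNIV. \<Sum>j\<in>UNIV. christoffel g p k i j * Y p $ i * X p $ j)" for k
    by (subst sum.swap) (simp add: sym[of k] mult.commute mult.left_commute)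
  then show ?thesis unfolding cov_deriv_def by simp
qed

lemma metric_expand:
  assumes g: "riemannian_metric_on U g" and p: "p \<in> U"
  shows "g p x y = (\<Sum>i\<in>UNIV. \<Sum>j\<in>UNIV. metric_matrix g p $ i $ j * x $ i * y $ j)"
proof -
  have bl: "bilinear (g p)" using g p unfolding riemannian_metric_on_def by auto
  have lin: "linear (\<lambda>x. g p x y)" "linear (g p x)" for x y
    using bl unfolding bilinear_def by auto
  have ex: "y = (\<Sum>i\<in>UNIV. y $ i *\<^sub>R axis i 1)" for y :: "real ^ 'a"
    by (simp add: basis_expansion flip: scalar_mult_eq_scaleR)
  have "g p x y = (\<Sum>i\<in>UNIV. x $ i * g p (axis i 1) y)"
    by (subst (1) ex[of x]) (simp add: linear_sum[OF lin(1)] linear_cmul[OF lin(1)])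
  also have "\<dots> = (\<Sum>i\<in>UNIV. \<Sum>j\<in>UNIV. metric_matrix g p $ i $ j * x $ i * y $ j)"
  proof (intro sum.cong refl)
    fix i
    have "g p (axis i 1) y = (\<Sum>j\<in>UNIV. y $ j * g p (axis i 1) (axis j 1))"
      by (subst (1) ex[of y]) (simp add: linear_sum[OF lin(2)] linear_cmul[OF lin(2)])
    then show "x $ i * g p (axis i 1) y = (\<Sum>j\<in>UNIV. metric_matrix g p $ i $ j * x $ i * y $ j)"
      by (simp add: sum_distrib_left metric_matrix_def coord_field_def algebra_simps)
  qed
  finally show ?thesis .
qed

lemma christoffel_lower:
  assumes g: "riemannian_metric_on U g" and p: "p \<in> U"
  shows "(\<Sum>k\<in>UNIV. metric_matrix g p $ m $ k * christoffel g p k i j) =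
     (pderiv_at i (\<lambda>q. metric_matrix g q $ j $ m) p
         + pderiv_at j (\<lambda>q. metric_matrix g q $ i $ m) p
         - pderiv_at m (\<lambda>q. metric_matrix g q $ i $ j) p) / 2"
proof -
  define c where "c l = pderiv_at i (\<lambda>q. metric_matrix g q $ j $ l) p
         + pderiv_at j (\<lambda>q. metric_matrix g q $ i $ l) p
         - pderiv_at l (\<lambda>q. metric_matrix g q $ i $ j) p" for l
  let ?G = "metric_matrix g p" and ?H = "matrix_inv (metric_matrix g p)"
  define w where "w = ?H *v (\<chi> l. c l)"
  have "(\<Sum>k\<in>UNIV. ?G $ m $ k * ((\<Sum>l\<in>UNIV. ?H $ k $ l * c l) / 2)) = (\<Sum>k\<in>UNIV. ?G $ m $ k * w $ k / 2)"
    by (simp add: matrix_vector_mult_def w_def)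
  also have "\<dots> = (?G *v w) $ m / 2"
    by (simp add: matrix_vector_mult_def sum_divide_distrib)
  also have "\<dots> = c m / 2"
    by (simp add: w_def matrix_vector_mul_assoc matrix_inv_metric[OF g p])
  finally show ?thesis unfolding christoffel_def c_def .
qed

lemma cov_deriv_metric_compatible:
  assumes g: "riemannian_metric_on U g" and U: "open U" and p: "p \<in> U"
    and Y: "Y differentiable (at p)" and Z: "Z differentiable (at p)"
  shows "frechet_derivative (\<lambda>q. g q (Y q) (Z q)) (at p) (X p) =
         g p (cov_deriv g X Y p) (Z p) + g p (Y p) (cov_deriv g X Z p)"
proof -
  let ?G = "\<lambda>i j q. metric_matrix g q $ i $ j"
  define dG where "dG i j = frechet_derivative (?G i j) (at p)" for i j
  define dY where "dY = frechet_derivative Y (at p)"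
  define dZ where "dZ = frechet_derivative Z (at p)"
  have G': "(?G i j has_derivative dG i j) (at p)" for i j
    unfolding dG_def using metric_matrix_differentiable[OF g p] frechet_derivative_works by blast
  have Y': "(Y has_derivative dY) (at p)" and Z': "(Z has_derivative dZ) (at p)"
    unfolding dY_def dZ_def using Y Z frechet_derivative_works by blast+
  have Yi: "((\<lambda>q. Y q $ i) has_derivative (\<lambda>h. dY h $ i)) (at p)" for i
    using Y' by (rule bounded_linear.has_derivative[OF bounded_linear_vec_nth])
  have Zi: "((\<lambda>q. Z q $ i) has_derivative (\<lambda>h. dZ h $ i)) (at p)" for i
    using Z' by (rule bounded_linear.has_derivative[OF bounded_linear_vec_nth])
  have "((\<lambda>q. \<Sum>i\<in>UNIV. \<Sum>j\<in>UNIV. ?G i j q * Y q $ i * Z q $ j) has_derivative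
      (\<lambda>h. \<Sum>i\<in>UNIV. \<Sum>j\<in>UNIV. dG i j h * Y p $ i * Z p $ j
        + ?G i j p * dY h $ i * Z p $ j + ?G i j p * Y p $ i * dZ h $ j)) (at p)"
    by (auto intro!: derivative_eq_intros G' Yi Zi simp: algebra_simps)
  then have "((\<lambda>q. g q (Y q) (Z q)) has_derivative
      (\<lambda>h. \<Sum>i\<in>UNIV. \<Sum>j\<in>UNIV. dG i j h * Y p $ i * Z p $ j
        + ?G i j p * dY h $ i * Z p $ j + ?G i j p * Y p $ i * dZ h $ j)) (at p)"
    by (rule has_derivative_transform_within_open[OF _ U p]) (simp add: metric_expand[OF g])
  then have lhs: "frechet_derivative (\<lambda>q. g q (Y q) (Z q)) (at p) (X p) =
      (\<Sum>i\<in>UNIV. \<Sum>j\<in>UNIV. dG i j (X p) * Y p $ i * Z p $ j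
        + ?G i j p * dY (X p) $ i * Z p $ j + ?G i j p * Y p $ i * dZ (X p) $ j)"
    by (simp add: frechet_derivative_at[symmetric])
  have bl: "bilinear (g p)" and gs: "\<And>x y. g p x y = g p y x"
    using g p unfolding riemannian_metric_on_def by auto
  define C where "C a W = (\<chi> k. \<Sum>i\<in>UNIV. \<Sum>j\<in>UNIV. christoffel g p k i j * a $ i * W $ j)"
    for a W :: "real ^ 'a"
  have gC: "g p (C a W) V = (\<Sum>m\<in>UNIV. \<Sum>j\<in>UNIV. \<Sum>i\<in>UNIV. (pderiv_at i (?G j m) p
         + pderiv_at j (?G i m) p - pderiv_at m (?G i j) p) / 2 * a $ i * W $ j * V $ m)" for a W V
  proof -
    have "g p (C a W) V = g p V (C a W)" by (rule gs)
    also have "\<dots> = (\<Sum>m\<in>UNIV. \<Sum>k\<in>UNIV. \<Sum>i\<in>UNIV. \<Sum>j\<in>UNIV.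
        ?G m k p * christoffel g p k i j * a $ i * W $ j * V $ m)"
      by (simp add: metric_expand[OF g p] C_def sum_distrib_left mult_ac)
    also have "\<dots> = (\<Sum>m\<in>UNIV. \<Sum>j\<in>UNIV. \<Sum>i\<in>UNIV. \<Sum>k\<in>UNIV.
        ?G m k p * christoffel g p k i j * a $ i * W $ j * V $ m)"
    proof (rule sum.cong[OF refl])
      fix m
      let ?f = "\<lambda>k i j. ?G m k p * christoffel g p k i j * a $ i * W $ j * V $ m"
      have "(\<Sum>k\<in>UNIV. \<Sum>i\<in>UNIV. \<Sum>j\<in>UNIV. ?f k i j) = (\<Sum>k\<in>UNIV. \<Sum>j\<in>UNIV. \<Sum>i\<in>UNIV. ?f k i j)"
        by (intro sum.cong refl sum.swap)
      also have "\<dots> = (\<Sum>j\<in>UNIV. \<Sum>k\<in>UNIV. \<Sum>i\<in>UNIV. ?f k i j)" by (rule sum.swap)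
      also have "\<dots> = (\<Sum>j\<in>UNIV. \<Sum>i\<in>UNIV. \<Sum>k\<in>UNIV. ?f k i j)"
        by (intro sum.cong refl sum.swap)
      finally show "(\<Sum>k\<in>UNIV. \<Sum>i\<in>UNIV. \<Sum>j\<in>UNIV. ?f k i j) = (\<Sum>j\<in>UNIV. \<Sum>i\<in>UNIV. \<Sum>k\<in>UNIV. ?f k i j)" .
    qed
    also have "\<dots> = (\<Sum>m\<in>UNIV. \<Sum>j\<in>UNIV. \<Sum>i\<in>UNIV. (\<Sum>k\<in>UNIV.
        ?G m k p * christoffel g p k i j) * a $ i * W $ j * V $ m)"
      by (simp add: sum_distrib_right)
    finally show ?thesis by (simp add: christoffel_lower[OF g p])
  qed
  have dGp: "dG i j a = (\<Sum>l\<in>UNIV. pderiv_at l (?G i j) p * a $ l)" for i j a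
  proof -
    have lin: "linear (dG i j)" using G' has_derivative_linear by blast
    have "dG i j a = dG i j (\<Sum>l\<in>UNIV. a $ l *\<^sub>R axis l 1)"
      by (simp add: basis_expansion flip: scalar_mult_eq_scaleR)
    also have "\<dots> = (\<Sum>l\<in>UNIV. a $ l * dG i j (axis l 1))"
      by (simp add: linear_sum[OF lin] linear_cmul[OF lin])
    finally show ?thesis by (simp add: pderiv_at_def dG_def mult.commute)
  qed
  define a where "a = X p"
  define y where "y = Y p"
  define z where "z = Z p"
  define P where "P l i j = pderiv_at l (?G i j) p" for l i j
  have Ps: "P l i j = P l j i" for l i j unfolding P_def by (rule pderiv_metric_sym[OF g U p])
  have "g p (C a y) z = (\<Sum>m\<in>UNIV. \<Sum>j\<in>UNIV. \<Sum>i\<in>UNIV. (P i j m + P j i m - P m i j) / 2 * a $ i * y $ j * z $ m)"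
    by (simp add: gC P_def)
  also have "\<dots> = (\<Sum>j\<in>UNIV. \<Sum>m\<in>UNIV. \<Sum>i\<in>UNIV. (P i j m + P j i m - P m i j) / 2 * a $ i * y $ j * z $ m)"
    by (rule sum.swap)
  finally have 1: "g p (C a y) z = (\<Sum>j\<in>UNIV. \<Sum>m\<in>UNIV. \<Sum>i\<in>UNIV. (P i j m + P j i m - P m i j) / 2 * a $ i * y $ j * z $ m)" .
  have 2: "g p y (C a z) = (\<Sum>j\<in>UNIV. \<Sum>m\<in>UNIV. \<Sum>i\<in>UNIV. (P i m j + P m i j - P j i m) / 2 * a $ i * z $ m * y $ j)"
    by (simp add: gs[of y] gC P_def)
  have "g p (C a y) z + g p y (C a z) = (\<Sum>j\<in>UNIV. \<Sum>m\<in>UNIV. \<Sum>i\<in>UNIV. P i j m * a $ i * y $ j * z $ m)"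
    unfolding 1 2 sum.distrib[symmetric]
  proof (intro sum.cong refl)
    fix j m i
    show "(P i j m + P j i m - P m i j) / 2 * a $ i * y $ j * z $ m
      + (P i m j + P m i j - P j i m) / 2 * a $ i * z $ m * y $ j = P i j m * a $ i * y $ j * z $ m"
      using Ps[of i m j] by (simp add: field_simps)
  qed
  also have "\<dots> = (\<Sum>i\<in>UNIV. \<Sum>j\<in>UNIV. dG i j a * y $ i * z $ j)"
    by (simp add: dGp P_def sum_distrib_right)
  finally have CC: "g p (C a y) z + g p y (C a z) = (\<Sum>i\<in>UNIV. \<Sum>j\<in>UNIV. dG i j a * y $ i * z $ j)" .
  have "g p (cov_deriv g X Y p) (Z p) + g p (Y p) (cov_deriv g X Z p) =
      g p (dY a) z + g p (C a y) z + (g p y (dZ a) + g p y (C a z))"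
    unfolding cov_deriv_def dY_def[symmetric] dZ_def[symmetric] a_def y_def z_def C_def
    using bl by (simp add: bilinear_ladd bilinear_radd)
  also have "\<dots> = (\<Sum>i\<in>UNIV. \<Sum>j\<in>UNIV. dG i j a * y $ i * z $ j) + g p (dY a) z + g p y (dZ a)"
    using CC by simp
  also have "\<dots> = (\<Sum>i\<in>UNIV. \<Sum>j\<in>UNIV. dG i j a * y $ i * z $ j
        + ?G i j p * dY a $ i * z $ j + ?G i j p * y $ i * dZ a $ j)"
    by (simp add: metric_expand[OF g p] sum.distrib)
  finally show ?thesis using lhs unfolding a_def y_def z_def by simp
qed

section \<open>Harmonic sections\<close>

definition local_orthonormal_frame ::
    "('n::finite) metric \<Rightarrow> (real ^ 'n) set \<Rightarrow> ('n \<Rightarrow> 'n vfield) \<Rightarrow> bool" where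
  "local_orthonormal_frame g V e \<longleftrightarrow>
     open V \<and> (\<forall>i. smooth_on V (e i)) \<and>
     (\<forall>p\<in>V. \<forall>i j. g p (e i p) (e j p) = (if i = j then 1 else 0))"

definition rough_laplacian ::
    "('n::finite) metric \<Rightarrow> ('n \<Rightarrow> 'n vfield) \<Rightarrow> 'n vfield \<Rightarrow> 'n vfield" where
  "rough_laplacian g e X p =
     (\<Sum>i\<in>UNIV. cov_deriv g (e i) (cov_deriv g (e i) X) p
               - cov_deriv g (cov_deriv g (e i) (e i)) X p)"

text \<open>
  The value of the rough Laplacian does not depend on the frame, and frames exist around
  every point by the Gram-Schmidt process; quantifying over all frames thus says that the
  rough Laplacian of \<open>X\<close> vanishes on all of \<open>U\<close>.
\<close>

definition harmonic_section :: "(real ^ 'n) set \<Rightarrow> ('n::finite) metric \<Rightarrow> 'n vfield \<Rightarrow> bool" where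
  "harmonic_section U g X \<longleftrightarrow>
     smooth_on U X \<and>
     (\<forall>V e. V \<subseteq> U \<and> local_orthonormal_frame g V e \<longrightarrow> (\<forall>p\<in>V. rough_laplacian g e X p = 0))"

section \<open>Translation surfaces\<close>

definition translation_param :: "(real \<Rightarrow> real) \<Rightarrow> (real \<Rightarrow> real) \<Rightarrow> real ^ 2 \<Rightarrow> real ^ 3" where
  "translation_param f h p = vector [p $ 1, p $ 2, f (p $ 1) + h (p $ 2)]"

text \<open>
  In the chart given by the parametrization, the surface becomes \<open>param_domain I J\<close> with the
  pullback metric, and \<open>\<partial>/\<partial>u\<close>, \<open>\<partial>/\<partial>v\<close> become \<open>coord_field 1\<close>, \<open>coord_field 2\<close>. Evaluated
  in coordinates, the pullback metric is the matrix in lemma \<open>translation_metric\<close> below.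
\<close>

definition param_domain :: "real set \<Rightarrow> real set \<Rightarrow> (real ^ 2) set" where
  "param_domain I J = {p. p $ 1 \<in> I \<and> p $ 2 \<in> J}"

definition induced_metric :: "(real ^ 'n \<Rightarrow> real ^ 'm) \<Rightarrow> ('n::finite) metric" where
  "induced_metric \<phi> p x y =
     frechet_derivative \<phi> (at p) x \<bullet> frechet_derivative \<phi> (at p) y"

lemma translation_param_derivative:
  assumes "f differentiable (at (p $ 1))" "h differentiable (at (p $ 2))"
  shows "(translation_param f h has_derivative
     (\<lambda>x. vector [x $ 1, x $ 2, deriv f (p $ 1) * x $ 1 + deriv h (p $ 2) * x $ 2])) (at p)"
proof -
  have f: "(f has_derivative (\<lambda>t. deriv f (p $ 1) * t)) (at (p $ 1))"
    and h: "(h has_derivative (\<lambda>t. deriv h (p $ 2) * t)) (at (p $ 2))"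
    using assms by (metis DERIV_deriv_iff_real_differentiable has_field_derivative_def)+
  have nth: "((\<lambda>q. q $ i) has_derivative (\<lambda>x. x $ i)) (at p)" for i
    by (rule bounded_linear.has_derivative[OF bounded_linear_vec_nth has_derivative_ident])
  have fp: "((\<lambda>q. f (q $ 1)) has_derivative (\<lambda>x. deriv f (p $ 1) * x $ 1)) (at p)"
    using has_derivative_compose[OF nth[of 1] f] by simp
  have hp: "((\<lambda>q. h (q $ 2)) has_derivative (\<lambda>x. deriv h (p $ 2) * x $ 2)) (at p)"
    using has_derivative_compose[OF nth[of 2] h] by simp
  have comp: "((\<lambda>q. translation_param f h q $ i) has_derivative
     (\<lambda>x. vector [x $ 1, x $ 2, deriv f (p $ 1) * x $ 1 + deriv h (p $ 2) * x $ 2] $ i)) (at p)"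
    for i :: 3
    using exhaust_3[of i] nth[of 1] nth[of 2] has_derivative_add[OF fp hp]
    by (auto simp: translation_param_def vector_3)
  show ?thesis
    by (subst has_derivative_componentwise_within) (auto simp: Basis_vec_def inner_axis comp)
qed

lemma translation_metric:
  assumes "f differentiable (at (p $ 1))" "h differentiable (at (p $ 2))"
  shows "metric_matrix (induced_metric (translation_param f h)) p =
    vector [vector [1 + (deriv f (p $ 1))\<^sup>2, deriv f (p $ 1) * deriv h (p $ 2)],
            vector [deriv f (p $ 1) * deriv h (p $ 2), 1 + (deriv h (p $ 2))\<^sup>2]]"
  using frechet_derivative_at[OF translation_param_derivative[OF assms], symmetric]
  by (simp add: vec_eq_iff forall_2 metric_matrix_def coord_field_def induced_metric_def
      inner_vec_def sum_3 vector_3 vector_2 axis_def power2_eq_square mult.commute)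

lemma open_param_domain:
  assumes "open I" "open J"
  shows "open (param_domain I J)"
proof -
  have "param_domain I J = (\<lambda>p. p $ 1) -` I \<inter> (\<lambda>p. p $ 2) -` J"
    by (auto simp: param_domain_def)
  then show ?thesis
    using assms by (auto intro!: open_Int open_vimage_vec_nth)
qed

lemma translation_metric_riemannian:
  assumes I: "open I" and J: "open J" and f: "smooth_on I f" and h: "smooth_on J h"
  shows "riemannian_metric_on (param_domain I J) (induced_metric (translation_param f h))"
proof -
  let ?U = "param_domain I J" and ?g = "induced_metric (translation_param f h)"
  have U: "open ?U" by (rule open_param_domain[OF I J])
  have fd: "f differentiable (at (p $ 1))" and hd: "h differentiable (at (p $ 2))" if "p \<in> ?U" for p
  proof -
    have "Ck_on (Suc 0) I f" "Ck_on (Suc 0) J h" using f h unfolding smooth_on_def by blast+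
    then show "f differentiable (at (p $ 1))" "h differentiable (at (p $ 2))"
      using that by (auto simp: param_domain_def)
  qed
  have fr: "frechet_derivative (translation_param f h) (at p) =
     (\<lambda>x. vector [x $ 1, x $ 2, deriv f (p $ 1) * x $ 1 + deriv h (p $ 2) * x $ 2])"
    if "p \<in> ?U" for p
    by (rule frechet_derivative_at[OF translation_param_derivative[OF fd[OF that] hd[OF that]], symmetric])
  have "bilinear (?g p)" if "p \<in> ?U" for p
  proof -
    have "linear (frechet_derivative (translation_param f h) (at p))"
      by (rule linear_frechet_derivative,
          rule differentiableI[OF translation_param_derivative[OF fd[OF that] hd[OF that]]])
    then show ?thesis
      unfolding bilinear_def induced_metric_def
      by (auto intro!: linearI simp: linear_add linear_cmul inner_add_left inner_add_right)
  qed
  moreover have "?g p x x > 0" if "p \<in> ?U" "x \<noteq> 0" for p x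
  proof -
    have "frechet_derivative (translation_param f h) (at p) x \<noteq> 0"
      using that(2) by (auto simp: fr[OF that(1)] vec_eq_iff forall_2 forall_3 vector_3)
    then show ?thesis by (simp add: induced_metric_def)
  qed
  moreover have "smooth_on ?U (\<lambda>p. metric_matrix ?g p $ i $ j)" for i j
    unfolding smooth_on_def
  proof
    fix k
    have F: "Ck_on k ?U (\<lambda>p. deriv f (p $ 1))"
      using smooth_on_deriv[OF I f] unfolding smooth_on_def
      by (intro Ck_on_nth[OF U]) (auto simp: param_domain_def)
    have H: "Ck_on k ?U (\<lambda>p. deriv h (p $ 2))"
      using smooth_on_deriv[OF J h] unfolding smooth_on_def
      by (intro Ck_on_nth[OF U]) (auto simp: param_domain_def)
    define m where "m p = (vector [vector [1 + deriv f (p $ 1) * deriv f (p $ 1), deriv f (p $ 1) * deriv h (p $ 2)],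
       vector [deriv f (p $ 1) * deriv h (p $ 2), 1 + deriv h (p $ 2) * deriv h (p $ 2)]] :: real ^ 2 ^ 2)"
      for p :: "real ^ 2"
    have "Ck_on k ?U (\<lambda>p. m p $ i $ j)"
      using exhaust_2[of i] exhaust_2[of j] F H U
      by (auto simp: m_def vector_2 intro!: Ck_on_add Ck_on_mult Ck_on_const)
    then show "Ck_on k ?U (\<lambda>p. metric_matrix ?g p $ i $ j)"
      by (rule Ck_on_cong[OF U]) (simp add: m_def translation_metric[OF fd hd] power2_eq_square)
  qed
  ultimately show ?thesis
    unfolding riemannian_metric_on_def by (auto simp: induced_metric_def inner_commute)
qed

end

theory Submission
  imports Defs
begin

text \<open>
  The second covariant derivative \<open>\<nabla>\<^sub>E \<nabla>\<^sub>F X - \<nabla>\<^bsub>\<nabla>\<^sub>E F\<^esub> X\<close> is tensorial in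
  \<open>E\<close> and \<open>F\<close>, so the rough Laplacian in any orthonormal frame is its trace against the
  inverse metric in the coordinate frame. Write \<open>s\<close>, \<open>t\<close>, \<open>w\<close> for the vectors of first, second
  and third derivatives of the summands. The metric is \<open>I + s s\<^sup>T\<close>, with inverse
  \<open>I - s s\<^sup>T / W\<close> for \<open>W = 1 + |s|\<^sup>2\<close>, and its only Christoffel symbols are
  \<open>\<Gamma>\<^sup>k\<^sub>i\<^sub>i = t\<^sub>i s\<^sub>k / W\<close>. For \<open>n = 2\<close> the components of the Laplacians of
  the two coordinate fields, multiplied by \<open>W\<^sup>3\<close>, are the left-hand sides of the four equations.
  For the converse implication an orthonormal frame has to exist; the symmetric square root of the
  inverse metric gives one on the whole domain.
\<close>

section \<open>Closure properties of \<open>Ck_on\<close>: real powers, finite sums, vector-valued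
  maps\<close>

lemma smooth_on_imp_differentiable:
  assumes "smooth_on S F" "x \<in> S"
  shows "F differentiable (at x)"
proof -
  have "Ck_on (Suc 0) S F"
    using assms(1) unfolding smooth_on_def by blast
  then show ?thesis
    using assms(2) by simp
qed

text \<open>The exponent varies in the induction because differentiation lowers it by one. The cases
  \<open>1/2\<close> and \<open>-1\<close> give the square root and the reciprocal in
  \<open>root_frame\<close>.\<close>

lemma Ck_on_powr:
  fixes F :: "'a::euclidean_space \<Rightarrow> real"
  assumes "open S" "Ck_on k S F" "\<And>x. x \<in> S \<Longrightarrow> F x > 0"
  shows "Ck_on k S (\<lambda>x. F x powr a)"
  using assms(2)
proof (induction k arbitrary: a)
  case 0
  then show ?case
    using assms(3) by (auto intro!: continuous_on_powr continuous_intros simp: less_imp_neq[THEN not_sym])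
next
  case (Suc k)
  have d: "((\<lambda>x. F x powr a) has_derivative
      (\<lambda>v. a * F x powr (a - 1) * frechet_derivative F (at x) v)) (at x)" if "x \<in> S" for x
  proof -
    have "(F has_derivative frechet_derivative F (at x)) (at x)"
      using Suc.prems that by (simp add: frechet_derivative_works)
    moreover have "((\<lambda>y. y powr a) has_derivative (\<lambda>t. a * F x powr (a - 1) * t)) (at (F x))"
      using has_real_derivative_powr[OF assms(3)[OF that], of a] by (simp add: has_field_derivative_def)
    ultimately show ?thesis
      by (rule has_derivative_compose)
  qed
  have "Ck_on k S (\<lambda>x. a * F x powr (a - 1) * frechet_derivative F (at x) v)" for v
    using Suc.prems Ck_on_Suc_imp[OF Suc.prems]
    by (intro Ck_on_mult assms(1) Suc.IH Ck_on_const) auto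
  then have "Ck_on k S (\<lambda>x. frechet_derivative (\<lambda>x. F x powr a) (at x) v)" for v
    by (rule Ck_on_cong[OF assms(1)]) (use frechet_derivative_at[OF d, symmetric] in auto)
  then show ?case
    using d by (auto simp: differentiable_def)
qed

lemma Ck_on_sum:
  assumes "open S" "\<And>i. i \<in> A \<Longrightarrow> Ck_on k S (F i)"
  shows "Ck_on k S (\<lambda>x. \<Sum>i\<in>A. F i x)"
  using assms(2)
proof (induction A rule: infinite_finite_induct)
  case (insert i A)
  then show ?case
    by (simp add: Ck_on_add[OF assms(1)])
qed (auto simp: Ck_on_const)

lemma has_derivative_vec_lambda:
  fixes F :: "'a::real_normed_vector \<Rightarrow> real ^ 'n"
  assumes "\<And>i. ((\<lambda>x. F x $ i) has_derivative (\<lambda>v. F' v $ i)) (at x)"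
  shows "(F has_derivative F') (at x)"
  by (subst has_derivative_componentwise_within) (auto simp: Basis_vec_def inner_axis assms)

lemma has_derivative_vec_nth:
  fixes F :: "'a::real_normed_vector \<Rightarrow> real ^ 'n"
  assumes "(F has_derivative F') (at x)"
  shows "((\<lambda>x. F x $ i) has_derivative (\<lambda>v. F' v $ i)) (at x)"
  by (rule bounded_linear.has_derivative[OF bounded_linear_vec_nth assms])

lemma Ck_on_vec:
  fixes F :: "'a::euclidean_space \<Rightarrow> real ^ 'n"
  assumes "open S" "\<And>i. Ck_on k S (\<lambda>x. F x $ i)"
  shows "Ck_on k S F"
  using assms(2)
proof (induction k arbitrary: F)
  case 0
  then show ?case
    using continuous_on_vec_lambda[of S "\<lambda>i x. F x $ i"] by simp
next
  case (Suc k)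
  have d: "(F has_derivative (\<lambda>v. \<chi> i. frechet_derivative (\<lambda>x. F x $ i) (at x) v)) (at x)"
    if "x \<in> S" for x
    using Suc.prems that by (intro has_derivative_vec_lambda) (simp add: frechet_derivative_works)
  have "Ck_on k S (\<lambda>x. \<chi> i. frechet_derivative (\<lambda>x. F x $ i) (at x) v)" for v
    by (rule Suc.IH) (use Suc.prems in auto)
  then have "Ck_on k S (\<lambda>x. frechet_derivative F (at x) v)" for v
    by (rule Ck_on_cong[OF assms(1)]) (use frechet_derivative_at[OF d, symmetric] in auto)
  then show ?case
    using d by (auto simp: differentiable_def)
qed

section \<open>Leibniz rules and the second covariant derivative\<close>

lemma cov_deriv_coord_field_nth:
  "cov_deriv g (coord_field i) Y p $ k =
     frechet_derivative Y (at p) (axis i 1) $ k + (\<Sum>j\<in>UNIV. christoffel g p k i j * Y p $ j)"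
proof -
  have "(\<Sum>a\<in>UNIV. \<Sum>j\<in>UNIV. christoffel g p k a j * axis i 1 $ a * Y p $ j) =
      (\<Sum>a\<in>UNIV. if i = a then \<Sum>j\<in>UNIV. christoffel g p k a j * Y p $ j else 0)"
    by (intro sum.cong refl) (simp add: axis_def)
  then show ?thesis
    by (simp add: cov_deriv_def coord_field_def)
qed

text \<open>The direction \<open>X\<close> enters only through its value at \<open>p\<close>.
  Differentiability of \<open>Y\<close> makes \<open>frechet_derivative Y (at p)\<close> linear, and
  the Christoffel term is linear in \<open>X p\<close> anyway.\<close>

lemma cov_deriv_coord_expand:
  assumes "Y differentiable (at p)"
  shows "cov_deriv g X Y p = (\<Sum>i\<in>UNIV. X p $ i *\<^sub>R cov_deriv g (coord_field i) Y p)"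
proof -
  have lin: "linear (frechet_derivative Y (at p))"
    using assms by (rule linear_frechet_derivative)
  have "frechet_derivative Y (at p) (X p) =
      frechet_derivative Y (at p) (\<Sum>i\<in>UNIV. X p $ i *\<^sub>R axis i 1)"
    by (simp add: basis_expansion flip: scalar_mult_eq_scaleR)
  also have "\<dots> = (\<Sum>i\<in>UNIV. X p $ i *\<^sub>R frechet_derivative Y (at p) (axis i 1))"
    by (simp add: linear_sum[OF lin] linear_cmul[OF lin])
  finally have 1: "frechet_derivative Y (at p) (X p) = \<dots>" .
  show ?thesis
    by (simp add: vec_eq_iff cov_deriv_coord_field_nth distrib_left sum.distrib)
       (simp add: cov_deriv_def 1 sum_distrib_left mult_ac)
qed

lemma cov_deriv_cong:
  assumes "open U" "p \<in> U" "\<And>q. q \<in> U \<Longrightarrow> Y q = Z q" "Y differentiable (at p)"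
  shows "cov_deriv g X Y p = cov_deriv g X Z p"
  using frechet_derivative_transform_within_open[OF assms(4,1,2,3)] assms(2,3)
  by (simp add: cov_deriv_def)

lemma cov_deriv_scaleR:
  assumes "\<phi> differentiable (at p)" "Y differentiable (at p)"
  shows "cov_deriv g X (\<lambda>q. \<phi> q *\<^sub>R Y q) p =
    frechet_derivative \<phi> (at p) (X p) *\<^sub>R Y p + \<phi> p *\<^sub>R cov_deriv g X Y p"
proof -
  have "((\<lambda>q. \<phi> q *\<^sub>R Y q) has_derivative
      (\<lambda>x. \<phi> p *\<^sub>R frechet_derivative Y (at p) x + frechet_derivative \<phi> (at p) x *\<^sub>R Y p)) (at p)"
    using assms by (intro has_derivative_scaleR) (simp_all add: frechet_derivative_works)
  from frechet_derivative_at[OF this, symmetric] show ?thesis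
    by (simp add: cov_deriv_def vec_eq_iff sum_distrib_left algebra_simps)
qed

lemma cov_deriv_sum:
  fixes X :: "('n::finite) vfield"
  assumes "finite A" "\<And>i. i \<in> A \<Longrightarrow> Y i differentiable (at p)"
  shows "cov_deriv g X (\<lambda>q. \<Sum>i\<in>A. Y i q) p = (\<Sum>i\<in>A. cov_deriv g X (Y i) p)"
proof -
  have "((\<lambda>q. \<Sum>i\<in>A. Y i q) has_derivative (\<lambda>x. \<Sum>i\<in>A. frechet_derivative (Y i) (at p) x)) (at p)"
    using assms by (intro has_derivative_sum) (simp add: frechet_derivative_works)
  note fr = frechet_derivative_at[OF this, symmetric]
  have "(\<Sum>a\<in>UNIV. \<Sum>b\<in>UNIV. C a b * (\<Sum>i\<in>A. Y i p $ b)) = 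
      (\<Sum>i\<in>A. \<Sum>a\<in>UNIV. \<Sum>b\<in>UNIV. C a b * Y i p $ b)" for C :: "'n \<Rightarrow> 'n \<Rightarrow> real"
  proof -
    have "(\<Sum>a\<in>UNIV. \<Sum>b\<in>UNIV. C a b * (\<Sum>i\<in>A. Y i p $ b)) =
       (\<Sum>a\<in>UNIV. \<Sum>i\<in>A. \<Sum>b\<in>UNIV. C a b * Y i p $ b)"
      unfolding sum_distrib_left by (intro sum.cong refl sum.swap)
    then show ?thesis
      by (simp add: sum.swap[of _ A])
  qed
  then show ?thesis
    by (simp add: cov_deriv_def fr vec_eq_iff sum.distrib)
qed

text \<open>The Leibniz rule in the differentiated field combined with linearity in the direction.
  It is applied with \<open>A m\<close> the field \<nabla>X along the \<open>m\<close>-th coordinate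
  field, and with \<open>A m = coord_field m\<close>; the first sum carries the derivatives of
  \<open>E\<close>.\<close>

lemma cov_deriv_coord_scaleR_sum:
  assumes "E differentiable (at p)" "\<And>m. A m differentiable (at p)"
  shows "cov_deriv g X (\<lambda>q. \<Sum>m\<in>UNIV. E q $ m *\<^sub>R A m q) p =
    (\<Sum>m\<in>UNIV. frechet_derivative E (at p) (X p) $ m *\<^sub>R A m p)
    + (\<Sum>m\<in>UNIV. \<Sum>l\<in>UNIV. (E p $ m * X p $ l) *\<^sub>R cov_deriv g (coord_field l) (A m) p)"
proof -
  have "(E has_derivative frechet_derivative E (at p)) (at p)"
    using assms(1) by (simp add: frechet_derivative_works)
  from has_derivative_vec_nth[OF this]
  have d: "((\<lambda>q. E q $ m) has_derivative (\<lambda>x. frechet_derivative E (at p) x $ m)) (at p)" for m .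
  have dm: "(\<lambda>q. E q $ m) differentiable (at p)" for m
    using d by (rule differentiableI)
  have "(\<lambda>q. E q $ m *\<^sub>R A m q) differentiable (at p)" for m
    using dm assms(2) by (rule differentiable_scaleR)
  then have "cov_deriv g X (\<lambda>q. \<Sum>m\<in>UNIV. E q $ m *\<^sub>R A m q) p =
      (\<Sum>m\<in>UNIV. cov_deriv g X (\<lambda>q. E q $ m *\<^sub>R A m q) p)"
    by (intro cov_deriv_sum) auto
  also have "\<dots> = (\<Sum>m\<in>UNIV. frechet_derivative E (at p) (X p) $ m *\<^sub>R A m p
      + E p $ m *\<^sub>R (\<Sum>l\<in>UNIV. X p $ l *\<^sub>R cov_deriv g (coord_field l) (A m) p))"
    by (simp add: cov_deriv_scaleR[OF dm assms(2)] frechet_derivative_at[OF d, symmetric]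
        flip: cov_deriv_coord_expand[OF assms(2)])
  finally show ?thesis
    by (simp add: sum.distrib scaleR_right.sum)
qed

definition second_cov_deriv ::
    "('n::finite) metric \<Rightarrow> 'n vfield \<Rightarrow> 'n vfield \<Rightarrow> 'n vfield \<Rightarrow> 'n vfield" where
  "second_cov_deriv g E F X p =
     cov_deriv g E (cov_deriv g F X) p - cov_deriv g (cov_deriv g E F) X p"

text \<open>The derivatives of \<open>E\<close> cancel between the two terms of \<open>second_cov_deriv\<close>, which
  is why it is a tensor.\<close>

lemma second_cov_deriv_coord_expand:
  assumes U: "open U" "p \<in> U"
    and X: "\<And>q. q \<in> U \<Longrightarrow> X differentiable (at q)"
    and DX: "\<And>m. cov_deriv g (coord_field m) X differentiable (at p)"
    and E: "E differentiable (at p)"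
  shows "second_cov_deriv g E E X p = (\<Sum>m\<in>UNIV. \<Sum>l\<in>UNIV.
    (E p $ m * E p $ l) *\<^sub>R second_cov_deriv g (coord_field l) (coord_field m) X p)"
proof -
  define A where "A m = cov_deriv g (coord_field m) X" for m
  have Ad: "A m differentiable (at p)" for m
    using DX by (simp add: A_def)
  have c: "(coord_field m :: 'a vfield) differentiable (at p)" for m
    by (simp add: coord_field_def)
  have "(\<lambda>q. E q $ m) differentiable (at p)" for m
    using E has_derivative_vec_nth unfolding differentiable_def by blast
  then have "(\<lambda>q. \<Sum>m\<in>UNIV. E q $ m *\<^sub>R A m q) differentiable (at p)"
    using Ad by (intro differentiable_sum differentiable_scaleR) auto
  \<comment> \<open>The expansion of \<nabla>X along \<open>E\<close> is differentiated again, so it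
    has to hold near \<open>p\<close> and not only at \<open>p\<close>; this is where
    differentiability of \<open>X\<close> on all of \<open>U\<close> enters.\<close>
  from cov_deriv_cong[OF U _ this, of "cov_deriv g E X" g E]
  have 1: "cov_deriv g E (cov_deriv g E X) p = cov_deriv g E (\<lambda>q. \<Sum>m\<in>UNIV. E q $ m *\<^sub>R A m q) p"
    by (simp add: A_def cov_deriv_coord_expand[OF X, of _ g E])
  have "E = (\<lambda>q. \<Sum>m\<in>UNIV. E q $ m *\<^sub>R coord_field m q)"
    by (rule ext) (simp add: coord_field_def basis_expansion flip: scalar_mult_eq_scaleR)
  then have "cov_deriv g E E p = cov_deriv g E (\<lambda>q. \<Sum>m\<in>UNIV. E q $ m *\<^sub>R coord_field m q) p"
    by simp
  also note cov_deriv_coord_scaleR_sum[OF E c]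
  also have "(\<Sum>m\<in>UNIV. frechet_derivative E (at p) (E p) $ m *\<^sub>R coord_field m p) =
      frechet_derivative E (at p) (E p)"
    by (simp add: coord_field_def basis_expansion flip: scalar_mult_eq_scaleR)
  finally have EE: "cov_deriv g E E p = frechet_derivative E (at p) (E p) +
      (\<Sum>m\<in>UNIV. \<Sum>l\<in>UNIV.
        (E p $ m * E p $ l) *\<^sub>R cov_deriv g (coord_field l) (coord_field m) p)" .
  have "cov_deriv g (cov_deriv g E E) X p = (\<Sum>i\<in>UNIV. cov_deriv g E E p $ i *\<^sub>R A i p)"
    by (simp add: A_def cov_deriv_coord_expand[OF X[OF U(2)], of g "cov_deriv g E E"])
  also have "\<dots> = (\<Sum>i\<in>UNIV. frechet_derivative E (at p) (E p) $ i *\<^sub>R A i p) +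
     (\<Sum>i\<in>UNIV. \<Sum>m\<in>UNIV. \<Sum>l\<in>UNIV. ((E p $ m * E p $ l) *
        cov_deriv g (coord_field l) (coord_field m) p $ i) *\<^sub>R A i p)"
    by (simp add: EE scaleR_add_left sum.distrib scaleR_sum_left)
  also have "(\<Sum>i\<in>UNIV. \<Sum>m\<in>UNIV. \<Sum>l\<in>UNIV. ((E p $ m * E p $ l) *
        cov_deriv g (coord_field l) (coord_field m) p $ i) *\<^sub>R A i p) =
     (\<Sum>m\<in>UNIV. \<Sum>l\<in>UNIV. \<Sum>i\<in>UNIV. ((E p $ m * E p $ l) *
        cov_deriv g (coord_field l) (coord_field m) p $ i) *\<^sub>R A i p)"
    by (subst sum.swap, intro sum.cong refl sum.swap)
  also have "\<dots> = (\<Sum>m\<in>UNIV. \<Sum>l\<in>UNIV. (E p $ m * E p $ l) *\<^sub>R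
        cov_deriv g (cov_deriv g (coord_field l) (coord_field m)) X p)"
    by (simp add: A_def scaleR_right.sum
        cov_deriv_coord_expand[OF X[OF U(2)], of g "cov_deriv g (coord_field _) (coord_field _)"])
  finally show ?thesis
    by (simp add: second_cov_deriv_def 1 cov_deriv_coord_scaleR_sum[OF E Ad]
        sum_subtractf scaleR_diff_right) (simp add: A_def)
qed

text \<open>With the \<open>e i\<close> as rows of \<open>M\<close>, orthonormality reads
  \<open>M ** G ** transpose M = mat 1\<close> for the metric matrix \<open>G\<close>. A one-sided
  inverse of a square matrix is two-sided, so the factors may be rotated to
  \<open>(transpose M ** M) ** G = mat 1\<close>.\<close>

lemma sum_orthonormal_frame:
  fixes e :: "'n::finite \<Rightarrow> real ^ 'n"
  assumes g: "riemannian_metric_on U g" "p \<in> U"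
    and e: "\<And>i j. g p (e i) (e j) = (if i = j then 1 else 0)"
  shows "(\<Sum>i\<in>UNIV. e i $ m * e i $ l) = matrix_inv (metric_matrix g p) $ m $ l"
proof -
  let ?G = "metric_matrix g p"
  define M where "M = (\<chi> i l. e i $ l)"
  have "(M ** ?G) ** transpose M = mat 1"
  proof -
    have "((M ** ?G) ** transpose M) $ i $ j = g p (e i) (e j)" for i j
    proof -
      have "((M ** ?G) ** transpose M) $ i $ j =
         (\<Sum>b\<in>UNIV. \<Sum>a\<in>UNIV. ?G $ a $ b * e i $ a * e j $ b)"
        by (simp add: matrix_matrix_mult_def transpose_def M_def sum_distrib_left mult_ac)
      also have "\<dots> = g p (e i) (e j)"
        unfolding metric_expand[OF g] by (rule sum.swap)
      finally show ?thesis .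
    qed
    then show ?thesis
      by (simp add: vec_eq_iff mat_def e)
  qed
  then have "(transpose M ** M) ** ?G = mat 1"
    by (metis matrix_left_right_inverse matrix_mul_assoc)
  then have "transpose M ** M = matrix_inv ?G"
    by (metis matrix_inv_metric[OF g] matrix_mul_assoc matrix_mul_lid matrix_mul_rid)
  moreover have "(transpose M ** M) $ m $ l = (\<Sum>i\<in>UNIV. e i $ m * e i $ l)"
    by (simp add: matrix_matrix_mult_def transpose_def M_def)
  ultimately show ?thesis
    by simp
qed

text \<open>By tensoriality only the values of the frame at \<open>p\<close> matter, and they enter
  only through the sum of the products \<open>e i p $ m * e i p $ l\<close>, which is the inverse
  metric. The right-hand side therefore does not mention the frame.\<close>

lemma rough_laplacian_eq_trace:
  assumes g: "riemannian_metric_on U g" and U: "open U" "p \<in> U"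
    and X: "\<And>q. q \<in> U \<Longrightarrow> X differentiable (at q)"
    and DX: "\<And>m. cov_deriv g (coord_field m) X differentiable (at p)"
    and e: "local_orthonormal_frame g V e" "p \<in> V"
  shows "rough_laplacian g e X p = (\<Sum>m\<in>UNIV. \<Sum>l\<in>UNIV.
    matrix_inv (metric_matrix g p) $ m $ l *\<^sub>R
      second_cov_deriv g (coord_field l) (coord_field m) X p)"
proof -
  let ?H = "\<lambda>m l. second_cov_deriv g (coord_field l) (coord_field m) X p"
  have ed: "e i differentiable (at p)" for i
    using e smooth_on_imp_differentiable unfolding local_orthonormal_frame_def by blast
  have on: "g p (e i p) (e j p) = (if i = j then 1 else 0)" for i j
    using e unfolding local_orthonormal_frame_def by blast
  have "rough_laplacian g e X p = (\<Sum>i\<in>UNIV. second_cov_deriv g (e i) (e i) X p)"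
    by (simp add: rough_laplacian_def second_cov_deriv_def)
  also have "\<dots> = (\<Sum>i\<in>UNIV. \<Sum>m\<in>UNIV. \<Sum>l\<in>UNIV. (e i p $ m * e i p $ l) *\<^sub>R ?H m l)"
    by (simp add: second_cov_deriv_coord_expand[OF U X DX ed])
  also have "\<dots> = (\<Sum>m\<in>UNIV. \<Sum>l\<in>UNIV. \<Sum>i\<in>UNIV. (e i p $ m * e i p $ l) *\<^sub>R ?H m l)"
    by (subst sum.swap, intro sum.cong refl sum.swap)
  also have "\<dots> = (\<Sum>m\<in>UNIV. \<Sum>l\<in>UNIV. (\<Sum>i\<in>UNIV. e i p $ m * e i p $ l) *\<^sub>R ?H m l)"
    by (simp add: scaleR_sum_left)
  finally show ?thesis
    by (simp add: sum_orthonormal_frame[OF g U(2) on])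
qed

section \<open>Graphs of sums of functions of one variable\<close>

text \<open>The metric of the graph of \<open>x \<mapsto> \<phi>\<^sub>1 (x\<^sub>1) + \<dots> + \<phi>\<^sub>n (x\<^sub>n)\<close>,
  with \<open>s $ i\<close>, \<open>t $ i\<close>, \<open>w $ i\<close> standing for the first three derivatives of \<open>\<phi>\<^sub>i\<close>.\<close>

locale translation_graph_metric =
  fixes U :: "(real ^ 'n::finite) set" and g :: "'n metric" and s t w :: "'n vfield"
  assumes open_U: "open U"
    and metric: "riemannian_metric_on U g"
    and metric_matrix_nth:
      "p \<in> U \<Longrightarrow> metric_matrix g p $ i $ j = (if i = j then 1 else 0) + s p $ i * s p $ j"
    and smooth_s: "smooth_on U (\<lambda>q. s q $ i)"
    and deriv_s: "p \<in> U \<Longrightarrow> (s has_derivative (\<lambda>x. \<chi> i. t p $ i * x $ i)) (at p)"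
    and deriv_t: "p \<in> U \<Longrightarrow> (t has_derivative (\<lambda>x. \<chi> i. w p $ i * x $ i)) (at p)"
begin

text \<open>This is the determinant of the metric matrix.\<close>

definition W :: "real ^ 'n \<Rightarrow> real" where
  "W q = 1 + (\<Sum>i\<in>UNIV. s q $ i * s q $ i)"

lemma sum_slope_squares: "(\<Sum>i\<in>UNIV. s q $ i * s q $ i) = W q - 1"
  by (simp add: W_def)

lemma W_ge_1: "W q \<ge> 1"
  by (simp add: W_def sum_nonneg)

lemma W_pos: "W q > 0"
  using W_ge_1[of q] by simp

text \<open>The Sherman-Morrison formula for a rank-one perturbation of the identity. Checking a
  left inverse is enough, since \<open>matrix_inv\<close> is already known to be a right
  inverse.\<close>

lemma matrix_inv_nth:
  assumes p: "p \<in> U"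
  shows "matrix_inv (metric_matrix g p) $ k $ l =
    (if k = l then 1 else 0) - s p $ k * s p $ l / W p"
proof -
  define H where "H = (\<chi> k l. (if k = l then 1 else 0) - s p $ k * s p $ l / W p)"
  have "(\<Sum>l\<in>UNIV. H $ k $ l * metric_matrix g p $ l $ j) = (if k = j then 1 else 0)" for k j
  proof -
    have "(\<Sum>l\<in>UNIV. H $ k $ l * metric_matrix g p $ l $ j) =
        (\<Sum>l\<in>UNIV. (if k = l then (if l = j then 1 else 0) + s p $ l * s p $ j else 0)
          - (if l = j then s p $ k * s p $ l / W p else 0)
          - s p $ k * s p $ j / W p * (s p $ l * s p $ l))"
      by (intro sum.cong refl) (simp add: H_def metric_matrix_nth[OF p] algebra_simps)
    also have "\<dots> = (if k = j then 1 else 0) + s p $ k * s p $ j - s p $ k * s p $ j / W p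
        - s p $ k * s p $ j / W p * (W p - 1)"
      unfolding sum_subtractf sum_distrib_left[symmetric] sum_slope_squares by simp
    also have "\<dots> = (if k = j then 1 else 0)"
      using W_pos[of p] by (simp add: field_simps)
    finally show ?thesis .
  qed
  then have "H ** metric_matrix g p = mat 1"
    by (simp add: vec_eq_iff matrix_matrix_mult_def mat_def)
  then have H: "matrix_inv (metric_matrix g p) = H"
    by (metis matrix_inv_metric[OF metric p] matrix_mul_assoc matrix_mul_lid matrix_mul_rid)
  then show ?thesis
    unfolding H by (simp add: H_def)
qed

text \<open>The derivative of \<open>s\<close> is diagonal, so a partial derivative in direction
  \<open>l\<close> sees only the factors with index \<open>l\<close>.\<close>

lemma pderiv_metric_matrix:
  assumes p: "p \<in> U"
  shows "pderiv_at l (\<lambda>q. metric_matrix g q $ i $ j) p =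
    (if i = l then t p $ i * s p $ j else 0) + (if j = l then s p $ i * t p $ j else 0)"
proof -
  have s: "((\<lambda>q. s q $ i) has_derivative (\<lambda>x. t p $ i * x $ i)) (at p)" for i
    using has_derivative_vec_nth[OF deriv_s[OF p]] by simp
  have "((\<lambda>q. (if i = j then 1 else 0) + s q $ i * s q $ j) has_derivative
      (\<lambda>x. 0 + (s p $ i * (t p $ j * x $ j) + t p $ i * x $ i * s p $ j))) (at p)"
    by (intro has_derivative_add has_derivative_mult s has_derivative_const)
  then have "((\<lambda>q. metric_matrix g q $ i $ j) has_derivative
      (\<lambda>x. 0 + (s p $ i * (t p $ j * x $ j) + t p $ i * x $ i * s p $ j))) (at p)"
    by (rule has_derivative_transform_within_open[OF _ open_U p]) (simp add: metric_matrix_nth)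
  from frechet_derivative_at[OF this, symmetric] show ?thesis
    by (simp add: pderiv_at_def axis_def)
qed

text \<open>In the combination of three derivatives of the metric the terms with
  \<open>i = l\<close> or \<open>j = l\<close> cancel, leaving \<open>2 * t p $ i * s p $ l\<close>
  for \<open>i = j\<close>. The inverse metric then acts on its eigenvector \<open>s p\<close> as
  division by \<open>W p\<close>.\<close>

lemma christoffel_eq:
  assumes p: "p \<in> U"
  shows "christoffel g p k i j = (if i = j then t p $ i * s p $ k / W p else 0)"
proof -
  have "christoffel g p k i j =
      (\<Sum>l\<in>UNIV. matrix_inv (metric_matrix g p) $ k $ l * (if i = j then 2 * t p $ i * s p $ l else 0)) / 2"
    unfolding christoffel_def
    by (intro arg_cong2[where f = "(/)"] sum.cong refl) (simp add: pderiv_metric_matrix[OF p])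
  also have "\<dots> = (if i = j then t p $ i * (\<Sum>l\<in>UNIV. matrix_inv (metric_matrix g p) $ k $ l * s p $ l) else 0)"
    by (simp add: sum_distrib_left sum_divide_distrib mult_ac)
  also have "(\<Sum>l\<in>UNIV. matrix_inv (metric_matrix g p) $ k $ l * s p $ l) =
      (\<Sum>l\<in>UNIV. (if k = l then s p $ l else 0) - s p $ k / W p * (s p $ l * s p $ l))"
    by (intro sum.cong refl) (simp add: matrix_inv_nth[OF p] algebra_simps)
  also have "\<dots> = s p $ k - s p $ k / W p * (W p - 1)"
    unfolding sum_subtractf sum_distrib_left[symmetric] sum_slope_squares by simp
  also have "\<dots> = s p $ k / W p"
    using W_pos[of p] by (simp add: field_simps)
  finally show ?thesis
    by simp
qed

section \<open>First and second covariant derivatives of the coordinate fields\<close>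

lemma cov_deriv_coord_field_coord_field:
  assumes p: "p \<in> U"
  shows "cov_deriv g (coord_field m) (coord_field c) p =
    (if m = c then (t p $ c / W p) *\<^sub>R s p else 0)"
proof -
  have "(\<Sum>j\<in>UNIV. christoffel g p k m j * axis c 1 $ j) = christoffel g p k m c" for k
    by (simp add: axis_def if_distrib cong: if_cong)
  then show ?thesis
    unfolding vec_eq_iff cov_deriv_coord_field_nth
    by (simp add: coord_field_def frechet_derivative_const) (simp add: christoffel_eq[OF p])
qed

text \<open>Covariant derivatives of coordinate fields are multiples of \<open>s\<close> with this
  factor, so differentiating them again needs only this derivative and that of
  \<open>s\<close>.\<close>

lemma deriv_slope_quotient:
  assumes p: "p \<in> U"
  shows "((\<lambda>q. t q $ c / W q) has_derivative
    (\<lambda>x. w p $ c * x $ c / W p - 2 * t p $ c * (\<Sum>i\<in>UNIV. s p $ i * t p $ i * x $ i) / (W p)\<^sup>2)) (at p)"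
proof -
  have s: "((\<lambda>q. s q $ i) has_derivative (\<lambda>x. t p $ i * x $ i)) (at p)" for i
    using has_derivative_vec_nth[OF deriv_s[OF p]] by simp
  have t: "((\<lambda>q. t q $ c) has_derivative (\<lambda>x. w p $ c * x $ c)) (at p)"
    using has_derivative_vec_nth[OF deriv_t[OF p]] by simp
  have "(W has_derivative
      (\<lambda>x. 0 + (\<Sum>i\<in>UNIV. s p $ i * (t p $ i * x $ i) + t p $ i * x $ i * s p $ i))) (at p)"
    unfolding W_def[abs_def] by (intro has_derivative_add has_derivative_sum has_derivative_mult s has_derivative_const)
  also have "(\<lambda>x. 0 + (\<Sum>i\<in>UNIV. s p $ i * (t p $ i * x $ i) + t p $ i * x $ i * s p $ i)) =
      (\<lambda>x. 2 * (\<Sum>i\<in>UNIV. s p $ i * t p $ i * x $ i))"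
    by (simp add: sum_distrib_left mult_ac)
  finally have W: "(W has_derivative (\<lambda>x. 2 * (\<Sum>i\<in>UNIV. s p $ i * t p $ i * x $ i))) (at p)" .
  have "((\<lambda>q. t q $ c / W q) has_derivative
    (\<lambda>x. (w p $ c * x $ c * W p - t p $ c * (2 * (\<Sum>i\<in>UNIV. s p $ i * t p $ i * x $ i))) / (W p * W p))) (at p)"
    using W_pos[of p] by (intro has_derivative_divide' t W) simp
  then show ?thesis
    using W_pos[of p] by (simp add: diff_divide_distrib power2_eq_square mult_ac)
qed

lemma cov_deriv_slope:
  assumes p: "p \<in> U"
  shows "cov_deriv g (coord_field l) s p $ k =
    (if k = l then t p $ l else 0) + t p $ l * s p $ l * s p $ k / W p"
proof -
  have "(\<Sum>j\<in>UNIV. christoffel g p k l j * s p $ j) =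
      (\<Sum>j\<in>UNIV. if l = j then t p $ l * s p $ k / W p * s p $ j else 0)"
    by (intro sum.cong refl) (simp add: christoffel_eq[OF p])
  then show ?thesis
    by (auto simp: cov_deriv_coord_field_nth frechet_derivative_at[OF deriv_s[OF p], symmetric] axis_def mult_ac)
qed

lemma differentiable_slope_quotient:
  assumes p: "p \<in> U"
  shows "(\<lambda>q. (t q $ c / W q) *\<^sub>R s q) differentiable (at p)"
  by (rule differentiable_scaleR[OF differentiableI[OF deriv_slope_quotient[OF p]]
        differentiableI[OF deriv_s[OF p]]])

lemma differentiable_cov_deriv_coord_field:
  assumes p: "p \<in> U"
  shows "cov_deriv g (coord_field m) (coord_field c) differentiable (at p)"
proof -
  have "(\<lambda>q. if m = c then (t q $ c / W q) *\<^sub>R s q else 0) differentiable (at p)"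
    by (cases "m = c") (simp_all add: differentiable_slope_quotient[OF p])
  then obtain D where
    "((\<lambda>q. if m = c then (t q $ c / W q) *\<^sub>R s q else 0) has_derivative D) (at p)"
    unfolding differentiable_def by blast
  \<comment> \<open>The explicit formula for the field is available only on \<open>U\<close>;
    openness of \<open>U\<close> transfers its derivative.\<close>
  then have "(cov_deriv g (coord_field m) (coord_field c) has_derivative D) (at p)"
    by (rule has_derivative_transform_within_open[OF _ open_U p])
       (simp add: cov_deriv_coord_field_coord_field)
  then show ?thesis
    by (rule differentiableI)
qed

text \<open>The Leibniz rule for \<open>(t q $ c / W q) *\<^sub>R s q\<close> gives the part with
  \<open>m = c\<close>. There the derivative of \<open>1 / W\<close> contributes its term twice, and
  the connection term of \<open>cov_deriv_slope\<close> cancels one copy. The part with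
  \<open>l = m\<close> is the correction along the field that
  \<open>cov_deriv_coord_field_coord_field\<close> gives.\<close>

lemma second_cov_deriv_coord_field:
  assumes p: "p \<in> U"
  shows "second_cov_deriv g (coord_field l) (coord_field m) (coord_field c) p $ k =
    (if m = c then ((if l = c then w p $ c / W p else 0) - t p $ c * s p $ l * t p $ l / (W p)\<^sup>2) * s p $ k
       + (if k = l then t p $ c * t p $ l / W p else 0) else 0)
    - (if l = m then t p $ l * s p $ c * t p $ c * s p $ k / (W p)\<^sup>2 else 0)"
proof -
  have ax: "(\<Sum>i\<in>UNIV. s p $ i * t p $ i * axis l 1 $ i) = s p $ l * t p $ l"
    by (simp add: axis_def if_distrib cong: if_cong)
  have "cov_deriv g (coord_field l) (cov_deriv g (coord_field m) (coord_field c)) p =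
      cov_deriv g (coord_field l) (\<lambda>q. if m = c then (t q $ c / W q) *\<^sub>R s q else 0) p"
    by (rule cov_deriv_cong[OF open_U p cov_deriv_coord_field_coord_field
          differentiable_cov_deriv_coord_field[OF p]])
  also have "\<dots> = (if m = c then cov_deriv g (coord_field l) (\<lambda>q. (t q $ c / W q) *\<^sub>R s q) p else 0)"
    by (simp add: cov_deriv_def frechet_derivative_const vec_eq_iff)
  also have "cov_deriv g (coord_field l) (\<lambda>q. (t q $ c / W q) *\<^sub>R s q) p =
      ((if l = c then w p $ c / W p else 0) - 2 * t p $ c * (s p $ l * t p $ l) / (W p)\<^sup>2) *\<^sub>R s p
      + (t p $ c / W p) *\<^sub>R cov_deriv g (coord_field l) s p"
    by (simp add: cov_deriv_scaleR[OF differentiableI[OF deriv_slope_quotient[OF p]]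
          differentiableI[OF deriv_s[OF p]]]
        frechet_derivative_at[OF deriv_slope_quotient[OF p], symmetric] coord_field_def ax)
       (simp add: axis_def)
  finally have 1: "cov_deriv g (coord_field l) (cov_deriv g (coord_field m) (coord_field c)) p $ k =
     (if m = c then ((if l = c then w p $ c / W p else 0) - t p $ c * s p $ l * t p $ l / (W p)\<^sup>2) * s p $ k
       + (if k = l then t p $ c * t p $ l / W p else 0) else 0)"
    using W_pos[of p] by (simp add: cov_deriv_slope[OF p] field_simps power2_eq_square)
  \<comment> \<open>This sum is the derivative of \<open>coord_field c\<close> in the direction
    \<open>s p\<close>; only the component \<open>i = c\<close> of the direction
    contributes.\<close>
  have "(\<Sum>i\<in>UNIV. s p $ i *\<^sub>R cov_deriv g (coord_field i) (coord_field c) p) =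
      (\<Sum>i\<in>UNIV. if i = c then (s p $ c * (t p $ c / W p)) *\<^sub>R s p else 0)"
    by (intro sum.cong refl) (simp add: cov_deriv_coord_field_coord_field[OF p])
  then have "(\<Sum>i\<in>UNIV. (r * s p $ i) *\<^sub>R cov_deriv g (coord_field i) (coord_field c) p) =
      (r * s p $ c * (t p $ c / W p)) *\<^sub>R s p" for r
    by (simp flip: scaleR_scaleR scaleR_right.sum) (simp add: mult.assoc)
  moreover have c: "(coord_field c :: 'n vfield) differentiable (at p)"
    by (simp add: coord_field_def)
  ultimately have "cov_deriv g (cov_deriv g (coord_field l) (coord_field m)) (coord_field c) p =
      (if l = m then (t p $ m / W p * s p $ c * (t p $ c / W p)) *\<^sub>R s p else 0)"
    unfolding cov_deriv_coord_expand[OF c, of g "cov_deriv g (coord_field l) (coord_field m)"]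
      cov_deriv_coord_field_coord_field[OF p, of l m]
    by (cases "l = m") (simp_all del: times_divide_eq_left times_divide_eq_right)
  then have 2: "cov_deriv g (cov_deriv g (coord_field l) (coord_field m)) (coord_field c) p $ k =
      (if l = m then t p $ l * s p $ c * t p $ c * s p $ k / (W p)\<^sup>2 else 0)"
    by (simp add: power2_eq_square mult_ac)
  show ?thesis
    by (simp only: second_cov_deriv_def vector_minus_component 1 2)
qed

text \<open>In the contraction with the inverse metric, \<open>m = c\<close> selects one row of it
  and \<open>l = m\<close> its diagonal. The sum over the diagonal is, up to the factor
  \<open>sqrt (W p)\<close> and the choice of normal, the trace of the second fundamental form of
  the graph.\<close>

lemma rough_laplacian_coord_field:
  assumes p: "p \<in> U" "p \<in> V" and e: "local_orthonormal_frame g V e"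
  shows "rough_laplacian g e (coord_field c) p $ k =
    (\<Sum>l\<in>UNIV. ((if c = l then 1 else 0) - s p $ c * s p $ l / W p) *
       (((if l = c then w p $ c / W p else 0) - t p $ c * s p $ l * t p $ l / (W p)\<^sup>2) * s p $ k
        + (if k = l then t p $ c * t p $ l / W p else 0)))
    - (\<Sum>l\<in>UNIV. (1 - s p $ l * s p $ l / W p) * t p $ l) * s p $ c * t p $ c * s p $ k / (W p)\<^sup>2"
    (is "_ = (\<Sum>l\<in>UNIV. ?i c l * ?a l) - ?b")
proof -
  have c: "(coord_field c :: 'n vfield) differentiable (at q)" for q
    by (simp add: coord_field_def)
  have "rough_laplacian g e (coord_field c) p $ k =
      (\<Sum>m\<in>UNIV. \<Sum>l\<in>UNIV. matrix_inv (metric_matrix g p) $ m $ l *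
         second_cov_deriv g (coord_field l) (coord_field m) (coord_field c) p $ k)"
    by (simp add: rough_laplacian_eq_trace[OF metric open_U p(1) c
          differentiable_cov_deriv_coord_field[OF p(1)] e p(2)])
  also have "\<dots> = (\<Sum>m\<in>UNIV. (if m = c then \<Sum>l\<in>UNIV. ?i m l * ?a l else 0)
     - (1 - s p $ m * s p $ m / W p) * (t p $ m * s p $ c * t p $ c * s p $ k / (W p)\<^sup>2))"
  proof (intro sum.cong refl)
    fix m
    have "(\<Sum>l\<in>UNIV. matrix_inv (metric_matrix g p) $ m $ l *
         second_cov_deriv g (coord_field l) (coord_field m) (coord_field c) p $ k) =
       (\<Sum>l\<in>UNIV. (if m = c then ?i m l * ?a l else 0)
         - (if l = m then ?i m l * (t p $ l * s p $ c * t p $ c * s p $ k / (W p)\<^sup>2) else 0))"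
      by (intro sum.cong refl)
         (simp only: second_cov_deriv_coord_field[OF p(1)] matrix_inv_nth[OF p(1)] right_diff_distrib
            if_distrib[where f = "times _"] mult_zero_right)
    then show "(\<Sum>l\<in>UNIV. matrix_inv (metric_matrix g p) $ m $ l *
         second_cov_deriv g (coord_field l) (coord_field m) (coord_field c) p $ k) =
       (if m = c then \<Sum>l\<in>UNIV. ?i m l * ?a l else 0)
     - (1 - s p $ m * s p $ m / W p) * (t p $ m * s p $ c * t p $ c * s p $ k / (W p)\<^sup>2)"
      unfolding sum_subtractf by (cases "m = c") (simp_all only: sum.delta finite if_True if_False sum.neutral_const UNIV_I simp_thms)
  qed
  also have "\<dots> = (\<Sum>l\<in>UNIV. ?i c l * ?a l) - ?b"
    unfolding sum_subtractf
    by (simp only: sum.delta finite UNIV_I if_True)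
       (simp only: sum_distrib_right sum_divide_distrib mult.assoc times_divide_eq_right)
  finally show ?thesis .
qed

text \<open>The columns of \<open>G\<^sup>-\<^sup>1\<^sup>/\<^sup>2\<close>, where \<open>G = I + s s\<^sup>T\<close> has eigenvalue
  \<open>W\<close> on \<open>s\<close> and 1 on its orthogonal complement.\<close>

definition root_frame :: "'n \<Rightarrow> 'n vfield" where
  "root_frame i q = axis i 1 - (s q $ i * (W q + W q powr (1/2)) powr (-1)) *\<^sub>R s q"

lemma metric_inner:
  assumes "p \<in> U"
  shows "g p x y = x \<bullet> y + (s p \<bullet> x) * (s p \<bullet> y)"
proof -
  have "g p x y = (\<Sum>i\<in>UNIV. \<Sum>j\<in>UNIV. (if i = j then x $ i * y $ j else 0) + s p $ i * x $ i * (s p $ j * y $ j))"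
    unfolding metric_expand[OF metric assms] by (intro sum.cong refl) (simp add: metric_matrix_nth[OF assms] algebra_simps)
  then show ?thesis
    by (simp add: sum.distrib inner_vec_def sum_product)
qed

text \<open>The matrix \<open>I - c s s\<^sup>T\<close> acts on \<open>s\<close> as
  \<open>1 / sqrt W\<close> when \<open>c * (W - 1) = 1 - 1 / sqrt W\<close>, which is solved by
  \<open>c = 1 / (W + sqrt W)\<close>. In this form nothing is divided by the squared length of
  \<open>s\<close>, so the frame stays smooth where \<open>s\<close> vanishes.\<close>

lemma local_orthonormal_frame_root_frame: "local_orthonormal_frame g U root_frame"
  unfolding local_orthonormal_frame_def
proof (intro conjI allI ballI)
  show "open U"
    by (rule open_U)
next
  fix i
  show "smooth_on U (root_frame i)"
    unfolding smooth_on_def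
  proof
    fix k
    have s: "Ck_on k U (\<lambda>q. s q $ i)" for i
      using smooth_s unfolding smooth_on_def by blast
    have W: "Ck_on k U W"
      unfolding W_def[abs_def] by (intro Ck_on_add Ck_on_sum Ck_on_mult Ck_on_const s open_U)
    have "Ck_on k U (\<lambda>q. axis i 1 $ j +
        (-1) * (s q $ i * (W q + W q powr (1/2)) powr (-1) * s q $ j))" for j
      by (intro Ck_on_add Ck_on_mult Ck_on_powr Ck_on_const s W open_U add_pos_nonneg W_pos powr_ge_zero)
    then show "Ck_on k U (root_frame i)"
      by (intro Ck_on_vec[OF open_U]) (simp add: root_frame_def[abs_def])
  qed
next
  fix p i j
  assume p: "p \<in> U"
  define r where "r = W p powr (1/2)"
  have r: "r > 0" "W p = r * r"
    using W_pos[of p] by (auto simp: r_def powr_half_sqrt)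
  define a where "a = (W p + r) powr (-1)"
  have a: "a = 1 / (r * r + r)"
    using r by (simp add: a_def powr_minus_divide)
  have ss: "s p \<bullet> s p = r * r - 1"
    using r(2) by (simp add: W_def inner_vec_def)
  have E: "root_frame i p = axis i 1 - (s p $ i * a) *\<^sub>R s p" for i
    by (simp add: root_frame_def a_def r_def)
  have sE: "s p \<bullet> root_frame i p = s p $ i * (1 - a * (r * r - 1))" for i
    by (simp add: E inner_diff_right ss inner_axis algebra_simps)
  have EE: "root_frame i p \<bullet> root_frame j p =
      (if i = j then 1 else 0) + s p $ i * s p $ j * (a * a * (r * r - 1) - 2 * a)"
    by (simp add: E inner_diff_right inner_diff_left ss inner_axis inner_axis' algebra_simps)
       (simp add: axis_def)
  have "r * r + r \<noteq> 0"
    using r(1) by (simp add: add_pos_pos less_imp_neq[THEN not_sym])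
  then have "a * (r * r + r) = 1"
    by (simp add: a)
  \<comment> \<open>This is the coefficient of \<open>s p $ i * s p $ j\<close> in the product of
    two frame vectors under \<open>g p\<close>. Since \<open>a = 1 / (r * (r + 1))\<close>, the
    summands are \<open>- 1 / (r * r)\<close> and \<open>(1 / r) * (1 / r)\<close>.\<close>
  then have "(a * a * (r * r - 1) - 2 * a) + (1 - a * (r * r - 1)) * (1 - a * (r * r - 1)) = 0"
    by algebra
  then show "g p (root_frame i p) (root_frame j p) = (if i = j then 1 else 0)"
    unfolding metric_inner[OF p] EE sE by algebra
qed

text \<open>One frame defined on all of \<open>U\<close> yields the equations at every point.
  Conversely they force the rough Laplacian to vanish in every frame, because its value involves no
  frame.\<close>

lemma harmonic_section_coord_field_iff:
  "harmonic_section U g (coord_field c) \<longleftrightarrow>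
    (\<forall>p\<in>U. \<forall>k.
      (\<Sum>l\<in>UNIV. ((if c = l then 1 else 0) - s p $ c * s p $ l / W p) *
         (((if l = c then w p $ c / W p else 0) - t p $ c * s p $ l * t p $ l / (W p)\<^sup>2) * s p $ k
          + (if k = l then t p $ c * t p $ l / W p else 0)))
      - (\<Sum>l\<in>UNIV. (1 - s p $ l * s p $ l / W p) * t p $ l) * s p $ c * t p $ c * s p $ k / (W p)\<^sup>2 = 0)"
    (is "?lhs \<longleftrightarrow> (\<forall>p\<in>U. \<forall>k. ?L p k = 0)")
proof
  assume ?lhs
  then have "rough_laplacian g root_frame (coord_field c) p = 0" if "p \<in> U" for p
    using that local_orthonormal_frame_root_frame unfolding harmonic_section_def by blast
  then show "\<forall>p\<in>U. \<forall>k. ?L p k = 0"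
    unfolding vec_eq_iff zero_index
    using rough_laplacian_coord_field[OF _ _ local_orthonormal_frame_root_frame] by simp
next
  assume L: "\<forall>p\<in>U. \<forall>k. ?L p k = 0"
  have "rough_laplacian g e (coord_field c) p = 0"
    if "V \<subseteq> U" "local_orthonormal_frame g V e" "p \<in> V" for V e p
  proof -
    have p: "p \<in> U"
      using that by blast
    show ?thesis
      unfolding vec_eq_iff rough_laplacian_coord_field[OF p that(3,2)] zero_index using L p by blast
  qed
  moreover have "smooth_on U (coord_field c)"
    unfolding smooth_on_def coord_field_def using Ck_on_const by blast
  ultimately show ?lhs
    unfolding harmonic_section_def by blast
qed

end

section \<open>Specialisation to translation surfaces\<close>

lemma translation_graph_metric_translation_param:
  assumes I: "open I" and J: "open J" and f: "smooth_on I f" and h: "smooth_on J h"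
  shows "translation_graph_metric (param_domain I J) (induced_metric (translation_param f h))
    (\<lambda>q. vector [deriv f (q $ 1), deriv h (q $ 2)])
    (\<lambda>q. vector [deriv (deriv f) (q $ 1), deriv (deriv h) (q $ 2)])
    (\<lambda>q. vector [deriv (deriv (deriv f)) (q $ 1), deriv (deriv (deriv h)) (q $ 2)])"
proof -
  let ?U = "param_domain I J"
  have U: "open ?U"
    by (rule open_param_domain[OF I J])
  have sf: "smooth_on I (deriv f)" "smooth_on I (deriv (deriv f))"
    and sh: "smooth_on J (deriv h)" "smooth_on J (deriv (deriv h))"
    by (intro smooth_on_deriv I J f h)+
  \<comment> \<open>Used twice: with the first derivatives of \<open>f\<close> and \<open>h\<close>
    for \<open>deriv_s\<close>, and with the second ones for \<open>deriv_t\<close>.\<close>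
  have vec_deriv: "((\<lambda>q :: real ^ 2. vector [F (q $ 1), H (q $ 2)] :: real ^ 2) has_derivative
      (\<lambda>x. \<chi> i. (vector [deriv F (p $ 1), deriv H (p $ 2)] :: real ^ 2) $ i * x $ i)) (at p)"
    if "smooth_on I F" "smooth_on J H" "p \<in> ?U" for F H p
  proof (rule has_derivative_vec_lambda)
    fix i :: 2
    have nth: "((\<lambda>q. q $ i) has_derivative (\<lambda>x. x $ i)) (at p)" for i
      by (rule has_derivative_vec_nth[OF has_derivative_ident])
    have "F differentiable (at (p $ 1))" "H differentiable (at (p $ 2))"
      using that smooth_on_imp_differentiable by (auto simp: param_domain_def)
    then have "(F has_derivative (\<lambda>x. deriv F (p $ 1) * x)) (at (p $ 1))"
      "(H has_derivative (\<lambda>x. deriv H (p $ 2) * x)) (at (p $ 2))"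
      by (metis DERIV_deriv_iff_real_differentiable has_field_derivative_def)+
    from has_derivative_compose[OF nth this(1)] has_derivative_compose[OF nth this(2)]
    show "((\<lambda>q. (vector [F (q $ 1), H (q $ 2)] :: real ^ 2) $ i) has_derivative
      (\<lambda>x. (\<chi> i. (vector [deriv F (p $ 1), deriv H (p $ 2)] :: real ^ 2) $ i * x $ i) $ i)) (at p)"
      using exhaust_2[of i] by auto
  qed
  show ?thesis
  proof
    show "open ?U" by (rule U)
    show "riemannian_metric_on ?U (induced_metric (translation_param f h))"
      by (rule translation_metric_riemannian[OF I J f h])
  next
    fix p i j
    assume "p \<in> ?U"
    then have "f differentiable (at (p $ 1))" "h differentiable (at (p $ 2))"
      using f h smooth_on_imp_differentiable by (auto simp: param_domain_def)
    then show "metric_matrix (induced_metric (translation_param f h)) p $ i $ j =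
        (if i = j then 1 else 0) + (vector [deriv f (p $ 1), deriv h (p $ 2)] :: real ^ 2) $ i *
          (vector [deriv f (p $ 1), deriv h (p $ 2)] :: real ^ 2) $ j"
      using exhaust_2[of i] exhaust_2[of j]
      by (auto simp: translation_metric vector_2 power2_eq_square)
  next
    fix i :: 2
    have "Ck_on k I (deriv f)" "Ck_on k J (deriv h)" for k
      using sf sh unfolding smooth_on_def by blast+
    from Ck_on_nth[OF U this(1), of 1] Ck_on_nth[OF U this(2), of 2]
    have "Ck_on k ?U (\<lambda>q. deriv f (q $ 1))" "Ck_on k ?U (\<lambda>q. deriv h (q $ 2))" for k
      by (simp_all add: param_domain_def)
    then show "smooth_on ?U (\<lambda>q. (vector [deriv f (q $ 1), deriv h (q $ 2)] :: real ^ 2) $ i)"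
      using exhaust_2[of i] by (auto simp: smooth_on_def)
  qed (intro vec_deriv f h sf sh; assumption)+
qed

text \<open>The left-hand sides keep the shape that \<open>harmonic_section_coord_field_iff\<close> takes for
  \<open>n = 2\<close> once the index tests are evaluated.\<close>

lemma laplacian_numerators:
  fixes a b p q r :: real
  assumes W: "W = 1 + a * a + b * b"
  shows "(1 - a * a / W) * ((r / W - p * a * p / W\<^sup>2) * a + p * p / W)
      + (0 - a * b / W) * ((0 - p * b * q / W\<^sup>2) * a + 0)
      - ((1 - a * a / W) * p + (1 - b * b / W) * q) * a * p * a / W\<^sup>2
      = (p^2 * (1 + b^2) * (1 + b^2 - a^2) + a * r * (1 + b^2) * (1 + b^2 + a^2)
          - a^2 * p * q * (1 + a^2 - b^2)) / W ^ 3"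
    and "(1 - a * a / W) * ((r / W - p * a * p / W\<^sup>2) * b + 0)
      + (0 - a * b / W) * ((0 - p * b * q / W\<^sup>2) * b + p * q / W)
      - ((1 - a * a / W) * p + (1 - b * b / W) * q) * a * p * b / W\<^sup>2
      = b * (r * (1 + b^2) * (1 + a^2 + b^2) - 2 * a * p * (q * (1 + a^2) + p * (1 + b^2))) / W ^ 3"
proof -
  \<comment> \<open>Replacing division by \<open>W\<close> with multiplication by \<open>V\<close>
    turns both sides into polynomials, which agree modulo the single relation
    \<open>V * (1 + a * a + b * b) = 1\<close>.\<close>
  define V where "V = 1 / W"
  have "a * a + b * b \<ge> 0"
    by simp
  then have "W \<noteq> 0"
    unfolding W by linarith
  then have V: "V * (1 + a * a + b * b) = 1"
    by (simp add: V_def flip: W add.assoc)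
  have d: "x / W = x * V" "x / W\<^sup>2 = x * V\<^sup>2" "x / W ^ 3 = x * V ^ 3" for x
    by (simp_all add: V_def power_divide)
  show "(1 - a * a / W) * ((r / W - p * a * p / W\<^sup>2) * a + p * p / W)
      + (0 - a * b / W) * ((0 - p * b * q / W\<^sup>2) * a + 0)
      - ((1 - a * a / W) * p + (1 - b * b / W) * q) * a * p * a / W\<^sup>2
      = (p^2 * (1 + b^2) * (1 + b^2 - a^2) + a * r * (1 + b^2) * (1 + b^2 + a^2)
          - a^2 * p * q * (1 + a^2 - b^2)) / W ^ 3"
    using V unfolding d by algebra
  show "(1 - a * a / W) * ((r / W - p * a * p / W\<^sup>2) * b + 0)
      + (0 - a * b / W) * ((0 - p * b * q / W\<^sup>2) * b + p * q / W)
      - ((1 - a * a / W) * p + (1 - b * b / W) * q) * a * p * b / W\<^sup>2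
      = b * (r * (1 + b^2) * (1 + a^2 + b^2) - 2 * a * p * (q * (1 + a^2) + p * (1 + b^2))) / W ^ 3"
    using V unfolding d by algebra
qed

theorem theorem1:
  fixes I J :: "real set" and f h :: "real \<Rightarrow> real"
  assumes "open I" "is_interval I" "open J" "is_interval J"
    and "smooth_on I f" "smooth_on J h"
  shows
    "(harmonic_section (param_domain I J) (induced_metric (translation_param f h)) (coord_field 1) \<and>
      harmonic_section (param_domain I J) (induced_metric (translation_param f h)) (coord_field 2))
     \<longleftrightarrow>
     (\<forall>u\<in>I. \<forall>v\<in>J.
        let f1 = deriv f u; f2 = (deriv ^^ 2) f u; f3 = (deriv ^^ 3) f u;
            h1 = deriv h v; h2 = (deriv ^^ 2) h v; h3 = (deriv ^^ 3) h v
        in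
          f2^2 * (1 + h1^2) * (1 + h1^2 - f1^2)
            + f1 * f3 * (1 + h1^2) * (1 + h1^2 + f1^2)
            - f1^2 * f2 * h2 * (1 + f1^2 - h1^2) = 0 \<and>
          h1 * (f3 * (1 + h1^2) * (1 + f1^2 + h1^2)
            - 2 * f1 * f2 * (h2 * (1 + f1^2) + f2 * (1 + h1^2))) = 0 \<and>
          f1 * (h3 * (1 + f1^2) * (1 + f1^2 + h1^2)
            - 2 * h1 * h2 * (f2 * (1 + h1^2) + h2 * (1 + f1^2))) = 0 \<and>
          h2^2 * (1 + f1^2) * (1 + f1^2 - h1^2)
            + h1 * h3 * (1 + f1^2) * (1 + f1^2 + h1^2)
            - h1^2 * h2 * f2 * (1 + h1^2 - f1^2) = 0)"
proof -
  let ?U = "param_domain I J" and ?g = "induced_metric (translation_param f h)"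
  let ?s = "\<lambda>q. vector [deriv f (q $ 1), deriv h (q $ 2)] :: real ^ 2"
  interpret translation_graph_metric ?U ?g ?s
    "\<lambda>q. vector [deriv (deriv f) (q $ 1), deriv (deriv h) (q $ 2)]"
    "\<lambda>q. vector [deriv (deriv (deriv f)) (q $ 1), deriv (deriv (deriv h)) (q $ 2)]"
    by (rule translation_graph_metric_translation_param[OF assms(1,3,5,6)])
  have W1: "W p = 1 + deriv f (p $ 1) * deriv f (p $ 1) + deriv h (p $ 2) * deriv h (p $ 2)"
    and W2: "W p = 1 + deriv h (p $ 2) * deriv h (p $ 2) + deriv f (p $ 1) * deriv f (p $ 1)" for p
    by (simp_all add: W_def sum_2)
  \<comment> \<open>A component of the Laplacian thus vanishes exactly when its numerator
    does.\<close>
  have W3: "W p ^ 3 \<noteq> 0" for p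
    using W_pos[of p] by simp
  have 1: "harmonic_section ?U ?g (coord_field 1) \<longleftrightarrow> (\<forall>p\<in>?U.
      let f1 = deriv f (p $ 1); f2 = deriv (deriv f) (p $ 1); f3 = deriv (deriv (deriv f)) (p $ 1);
          h1 = deriv h (p $ 2); h2 = deriv (deriv h) (p $ 2)
      in
        f2^2 * (1 + h1^2) * (1 + h1^2 - f1^2)
          + f1 * f3 * (1 + h1^2) * (1 + h1^2 + f1^2)
          - f1^2 * f2 * h2 * (1 + f1^2 - h1^2) = 0 \<and>
        h1 * (f3 * (1 + h1^2) * (1 + f1^2 + h1^2)
          - 2 * f1 * f2 * (h2 * (1 + f1^2) + f2 * (1 + h1^2))) = 0)"
    unfolding harmonic_section_coord_field_iff
  proof (intro ball_cong refl, goal_cases)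
    case (1 p)
    \<comment> \<open>Here \<open>a\<close>, \<open>p\<close>, \<open>r\<close> are the first three
      derivatives of \<open>f\<close>, and \<open>b\<close>, \<open>q\<close> the first two of
      \<open>h\<close>; the components \<open>k = 1\<close> and \<open>k = 2\<close> give the first
      and second equations.\<close>
    note n = laplacian_numerators[OF W1[of p], of "deriv (deriv (deriv f)) (p $ 1)"
        "deriv (deriv f) (p $ 1)" "deriv (deriv h) (p $ 2)"]
    show ?case
      unfolding forall_2 sum_2 vector_2 Let_def
      using n W3[of p] by simp
  qed
  have 2: "harmonic_section ?U ?g (coord_field 2) \<longleftrightarrow> (\<forall>p\<in>?U.
      let f1 = deriv f (p $ 1); f2 = deriv (deriv f) (p $ 1);
          h1 = deriv h (p $ 2); h2 = deriv (deriv h) (p $ 2); h3 = deriv (deriv (deriv h)) (p $ 2)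
      in
        f1 * (h3 * (1 + f1^2) * (1 + f1^2 + h1^2)
          - 2 * h1 * h2 * (f2 * (1 + h1^2) + h2 * (1 + f1^2))) = 0 \<and>
        h2^2 * (1 + f1^2) * (1 + f1^2 - h1^2)
          + h1 * h3 * (1 + f1^2) * (1 + f1^2 + h1^2)
          - h1^2 * h2 * f2 * (1 + h1^2 - f1^2) = 0)"
    unfolding harmonic_section_coord_field_iff
  proof (intro ball_cong refl, goal_cases)
    case (1 p)
    \<comment> \<open>The roles of \<open>f\<close> and \<open>h\<close> are exchanged, and with
      them the components: \<open>k = 1\<close> is now the transverse one and gives the third
      equation, \<open>k = 2\<close> the fourth.\<close>
    note n = laplacian_numerators[OF W2[of p], of "deriv (deriv (deriv h)) (p $ 2)"
        "deriv (deriv h) (p $ 2)" "deriv (deriv f) (p $ 1)"]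
    show ?case
      unfolding forall_2 sum_2 vector_2 Let_def
      using n W3[of p] by (simp add: add_ac)
  qed
  have U: "(\<forall>u\<in>I. \<forall>v\<in>J. P u v) \<longleftrightarrow> (\<forall>p\<in>?U. P (p $ 1) (p $ 2))" for P
  proof
    assume P: "\<forall>p\<in>?U. P (p $ 1) (p $ 2)"
    show "\<forall>u\<in>I. \<forall>v\<in>J. P u v"
    proof (intro ballI)
      fix u v
      assume "u \<in> I" "v \<in> J"
      then show "P u v"
        using P[rule_format, of "vector [u, v]"] by (simp add: param_domain_def)
    qed
  qed (simp add: param_domain_def)
  have d: "(deriv ^^ 2) F = deriv (deriv F)" "(deriv ^^ 3) F = deriv (deriv (deriv F))"
    for F :: "real \<Rightarrow> real"
    by (simp_all add: numeral_eq_Suc)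
  show ?thesis
    unfolding 1 2 d Let_def ball_conj_distrib[symmetric] U conj_assoc ..
qed

end
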